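(* Let $\Omega\subseteq\mathbb{R}^N$ be a bounded domain whose boundary $\partial\Omega$ is of class $C^2$ and which contains the origin in its interior, and let $r=\sqrt{x_1^2+\dots+x_N^2}$. Let $\alpha$, $c_0$, $c_1$ be (real) constants, and suppose there exists a function $u\in C^2(\overline{\Omega})$ satisfying $$\Delta u=-r^{\alpha}\ \text{ in }\Omega,\qquad u=0\ \text{ on }\partial\Omega,\qquad \sum_{i=1}^N x_i\frac{\partial u}{\partial x_i}+c_0\,r^{2+\alpha}+c_1=0\ \text{ on }\partial\Omega.$$ If $\beta:=(\alpha+2)\bigl(c_0(\alpha+N)-1\bigr)$ is not a negative integer, then $\Omega$ is an $N$-dimensional (Euclidean) ball.
   Context: A domain is a nonempty connected open set. $u\in C^2(\overline{\Omega})$ means that $u$ is twice continuously differentiable in $\Omega$ with all derivatives up to order $2$ extending continuously to $\overline{\Omega}$. *)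

theory Defs
  imports "HOL-Analysis.Analysis"
begin

definition partial_deriv :: "'n \<Rightarrow> (real ^ 'n \<Rightarrow> real) \<Rightarrow> real ^ 'n \<Rightarrow> real" where
  "partial_deriv i f x = deriv (\<lambda>t. f (x + t *\<^sub>R axis i 1)) 0"

definition laplacian :: "(real ^ 'n \<Rightarrow> real) \<Rightarrow> real ^ 'n \<Rightarrow> real" where
  "laplacian f x = (\<Sum>i\<in>UNIV. partial_deriv i (partial_deriv i f) x)"

(* C1_on and C2_on are meant for open sets S. *)
definition C1_on :: "(real ^ 'n) set \<Rightarrow> (real ^ 'n \<Rightarrow> real) \<Rightarrow> bool" where
  "C1_on S f \<longleftrightarrow>
     (\<forall>x\<in>S. f differentiable (at x)) \<and> (\<forall>i. continuous_on S (partial_deriv i f))"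

definition C2_on :: "(real ^ 'n) set \<Rightarrow> (real ^ 'n \<Rightarrow> real) \<Rightarrow> bool" where
  "C2_on S f \<longleftrightarrow> C1_on S f \<and> (\<forall>i. C1_on S (partial_deriv i f))"

definition extends_to_closure :: "(real ^ 'n) set \<Rightarrow> (real ^ 'n \<Rightarrow> real) \<Rightarrow> bool" where
  "extends_to_closure S f \<longleftrightarrow>
     (\<exists>g. continuous_on (closure S) g \<and> (\<forall>x\<in>S. g x = f x))"

(* The values of f on the frontier of S are those of its continuous extension.  The frontier
   values of a partial derivative are not given by partial_deriv itself, whose value there depends
   on f outside the closure; they are Lim (at x within S) (partial_deriv i f). *)
definition C2_closure :: "(real ^ 'n) set \<Rightarrow> (real ^ 'n \<Rightarrow> real) \<Rightarrow> bool" where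
  "C2_closure S f \<longleftrightarrow>
     C2_on S f \<and>
     continuous_on (closure S) f \<and>
     (\<forall>i. extends_to_closure S (partial_deriv i f)) \<and>
     (\<forall>i j. extends_to_closure S (partial_deriv j (partial_deriv i f)))"

(* Near each frontier point S is the strict epigraph, in some direction e, of a C2 function on the
   hyperplane orthogonal to e.  That function is represented by a C2 function g on the whole
   space, of which only the restriction to the hyperplane is used. *)
definition C2_boundary :: "(real ^ 'n) set \<Rightarrow> bool" where
  "C2_boundary S \<longleftrightarrow>
     (\<forall>p\<in>frontier S. \<exists>d>0. \<exists>e g. norm e = 1 \<and> C2_on UNIV g \<and>
        S \<inter> ball p d = {y \<in> ball p d. g (y - (y \<bullet> e) *\<^sub>R e) < y \<bullet> e})"

(* r to the power a.  The case a = 0 is separate because 0 powr 0 = 0, whereas the constant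
   function 1 is meant.  For a < 0 the value at the origin is irrelevant: no function that is C2
   near the origin has Laplacian - r powr a away from it. *)
definition radial_power :: "real \<Rightarrow> real ^ 'n \<Rightarrow> real" where
  "radial_power a x = (if a = 0 then 1 else norm x powr a)"

end

theory Submission
  imports Defs
begin

text \<open>For \<open>\<alpha> < 0\<close> no such \<open>u\<close> exists. Otherwise put \<open>p = 2 + \<alpha>\<close> and \<open>A = - 1 / (p (\<alpha> + N))\<close>, so that
  \<open>v = u - A r\<^sup>p\<close> is harmonic. The function \<open>x \<bullet> \<nabla>v + \<beta> v + c\<^sub>1\<close> is harmonic and, by the choice of
  \<open>\<beta>\<close>, vanishes on the frontier, hence everywhere. So \<open>v\<close> minus a constant is homogeneous of degree
  \<open>- \<beta>\<close> along every segment from the origin inside \<open>\<Omega>\<close>. As \<open>- \<beta>\<close> is not a positive integer, a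
  harmonic function near the origin with this homogeneity is zero, so that \<open>u = A r\<^sup>p + \<kappa>\<close> on the
  part of \<open>\<Omega>\<close> visible from the origin. Since \<open>u = 0\<close> on the frontier, every ray from the origin
  first leaves \<open>\<Omega>\<close> at the same distance.

  Smoothness of harmonic functions is avoided: everything rests on the maximum principle, through an
  interior bound for differences of harmonic functions in place of derivative estimates.\<close>

section \<open>Second derivatives along lines and pointwise Laplacians\<close>

text \<open>A relation rather than an iterated \<open>deriv\<close>, so that sums, multiples and
  rescalings carry over without separate differentiability conditions. As \<open>nhds 0\<close>
  includes 0 itself, \<open>g 0\<close> is the first derivative at 0.\<close>

definition has_second_deriv0 :: "(real \<Rightarrow> real) \<Rightarrow> real \<Rightarrow> bool" where
  "has_second_deriv0 f D \<longleftrightarrow>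
     (\<exists>g. (\<forall>\<^sub>F t in nhds 0. (f has_real_derivative g t) (at t)) \<and> (g has_real_derivative D) (at 0))"

lemma has_second_deriv0_cmult:
  assumes "has_second_deriv0 f D"
  shows "has_second_deriv0 (\<lambda>t. c * f t) (c * D)"
proof -
  from assms obtain g where g: "\<forall>\<^sub>F t in nhds 0. (f has_real_derivative g t) (at t)"
    "(g has_real_derivative D) (at 0)"
    unfolding has_second_deriv0_def by blast
  have "\<forall>\<^sub>F t in nhds 0. ((\<lambda>t. c * f t) has_real_derivative c * g t) (at t)"
    using g(1) by eventually_elim (rule DERIV_cmult)
  with DERIV_cmult[OF g(2), of c] show ?thesis
    unfolding has_second_deriv0_def by (intro exI conjI)
qed

lemma has_second_deriv0_add:
  assumes "has_second_deriv0 f D" "has_second_deriv0 f' D'"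
  shows "has_second_deriv0 (\<lambda>t. f t + f' t) (D + D')"
proof -
  from assms obtain g g' where g: "\<forall>\<^sub>F t in nhds 0. (f has_real_derivative g t) (at t)"
    "(g has_real_derivative D) (at 0)" "\<forall>\<^sub>F t in nhds 0. (f' has_real_derivative g' t) (at t)"
    "(g' has_real_derivative D') (at 0)"
    unfolding has_second_deriv0_def by blast
  have "\<forall>\<^sub>F t in nhds 0. ((\<lambda>t. f t + f' t) has_real_derivative g t + g' t) (at t)"
    using g(1,3) by eventually_elim (rule DERIV_add)
  with DERIV_add[OF g(2,4)] show ?thesis
    unfolding has_second_deriv0_def by (intro exI conjI)
qed

lemma has_second_deriv0_scale:
  assumes "has_second_deriv0 f D"
  shows "has_second_deriv0 (\<lambda>t. f (c * t)) (c\<^sup>2 * D)"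
proof -
  from assms obtain g where g: "\<forall>\<^sub>F t in nhds 0. (f has_real_derivative g t) (at t)"
    "(g has_real_derivative D) (at 0)"
    unfolding has_second_deriv0_def by blast
  have "((\<lambda>t. c * t) \<longlongrightarrow> 0) (nhds 0)"
    using tendsto_mult_left[OF tendsto_ident_at[of 0 UNIV], of c]
    by (simp add: tendsto_nhds_iff)
  then have "\<forall>\<^sub>F t in nhds 0. (f has_real_derivative g (c * t)) (at (c * t))"
    using eventually_compose_filterlim[OF g(1)] by blast
  then have "\<forall>\<^sub>F t in nhds 0. ((\<lambda>t. f (c * t)) has_real_derivative c * g (c * t)) (at t)"
  proof eventually_elim
    case (elim t)
    have "((\<lambda>t. c * t) has_real_derivative c) (at t)"
      by (auto intro!: derivative_eq_intros)
    from DERIV_chain2[OF elim this] show ?case by (simp add: mult.commute)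
  qed
  moreover have "((\<lambda>t. c * g (c * t)) has_real_derivative c\<^sup>2 * D) (at 0)"
  proof -
    have "((\<lambda>t. c * t) has_real_derivative c) (at 0)"
      by (auto intro!: derivative_eq_intros)
    moreover have "(g has_real_derivative D) (at (c * 0))" using g(2) by simp
    ultimately have "((\<lambda>t. g (c * t)) has_real_derivative D * c) (at 0)"
      using DERIV_chain2 by blast
    from DERIV_cmult[OF this, of c] show ?thesis by (simp add: power2_eq_square mult_ac)
  qed
  ultimately show ?thesis unfolding has_second_deriv0_def by (intro exI conjI)
qed

lemma has_second_deriv0_quadratic:
  "has_second_deriv0 (\<lambda>t. a + b * t + c * t\<^sup>2) (2 * c)"
  unfolding has_second_deriv0_def
  by (rule exI[of _ "\<lambda>t. b + 2 * c * t"]) (auto intro!: derivative_eq_intros always_eventually)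

text \<open>At the maximum \<open>g 0 = 0\<close>. If \<open>D > 0\<close>, then \<open>g\<close> is
  positive just to the right of 0, so \<open>f\<close> would increase strictly there.\<close>

lemma has_second_deriv0_local_max:
  assumes "has_second_deriv0 f D" "d > 0" "\<And>t. \<bar>t\<bar> < d \<Longrightarrow> f t \<le> f 0"
  shows "D \<le> 0"
proof (rule ccontr)
  assume "\<not> D \<le> 0"
  from assms(1) obtain g where g: "\<forall>\<^sub>F t in nhds 0. (f has_real_derivative g t) (at t)"
    "(g has_real_derivative D) (at 0)"
    unfolding has_second_deriv0_def by blast
  from g(1) obtain d1 where d1: "d1 > 0" "\<And>t. \<bar>t\<bar> < d1 \<Longrightarrow> (f has_real_derivative g t) (at t)"
    unfolding eventually_nhds_metric by (auto simp: dist_real_def)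
  have g0: "g 0 = 0"
    using DERIV_local_max[OF d1(2) assms(2)] assms(3) d1(1) by auto
  from DERIV_pos_inc_right[OF g(2)] \<open>\<not> D \<le> 0\<close> obtain d2 where
    d2: "d2 > 0" "\<And>h. 0 < h \<Longrightarrow> h < d2 \<Longrightarrow> g 0 < g h" by auto
  define h where "h = min d (min d1 d2) / 2"
  have h: "0 < h" "h < d" "h < d1" "h < d2" using d1(1) d2(1) assms(2) by (auto simp: h_def)
  have "f 0 < f h"
  proof (rule DERIV_pos_imp_increasing_open[OF h(1)])
    fix t assume "0 < t" "t < h"
    then show "\<exists>y. (f has_real_derivative y) (at t) \<and> y > 0"
      using d1(2)[of t] d2(2)[of t] g0 h by auto
  next
    show "continuous_on {0..h} f"
    proof (intro continuous_at_imp_continuous_on ballI)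
      fix t assume "t \<in> {0..h}"
      then show "isCont f t" using DERIV_isCont[OF d1(2)[of t]] h by auto
    qed
  qed
  with assms(3)[of h] h show False by auto
qed

text \<open>Only the pure second derivatives along the axes enter. This notion survives translation,
  scaling and reflection, and it suffices for the second derivative test at a maximum.\<close>

definition has_laplacian :: "(real ^ 'n \<Rightarrow> real) \<Rightarrow> real \<Rightarrow> real ^ 'n \<Rightarrow> bool" where
  "has_laplacian f L x \<longleftrightarrow>
     (\<exists>D. (\<forall>i. has_second_deriv0 (\<lambda>t. f (x + t *\<^sub>R axis i 1)) (D i)) \<and> (\<Sum>i\<in>UNIV. D i) = L)"

lemma has_laplacian_cmult:
  "has_laplacian f L x \<Longrightarrow> has_laplacian (\<lambda>y. c * f y) (c * L) x"
  unfolding has_laplacian_def by (force simp: sum_distrib_left intro: has_second_deriv0_cmult)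

lemma has_laplacian_add:
  assumes "has_laplacian f L x" "has_laplacian f' L' x"
  shows "has_laplacian (\<lambda>y. f y + f' y) (L + L') x"
proof -
  from assms obtain D D' where
    "\<And>i. has_second_deriv0 (\<lambda>t. f (x + t *\<^sub>R axis i 1)) (D i)" "(\<Sum>i\<in>UNIV. D i) = L"
    "\<And>i. has_second_deriv0 (\<lambda>t. f' (x + t *\<^sub>R axis i 1)) (D' i)" "(\<Sum>i\<in>UNIV. D' i) = L'"
    unfolding has_laplacian_def by blast
  then show ?thesis unfolding has_laplacian_def
    by (intro exI[of _ "\<lambda>i. D i + D' i"]) (auto simp: sum.distrib intro: has_second_deriv0_add)
qed

lemma has_laplacian_diff:
  assumes "has_laplacian f L x" "has_laplacian f' L' x"
  shows "has_laplacian (\<lambda>y. f y - f' y) (L - L') x"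
  using has_laplacian_add[OF assms(1) has_laplacian_cmult[OF assms(2), of "-1"]] by simp

lemma has_laplacian_const: "has_laplacian (\<lambda>y. c) 0 x"
  unfolding has_laplacian_def
  using has_second_deriv0_quadratic[of c 0 0] by (intro exI[of _ "\<lambda>i. 0"]) auto

lemma norm_axis_line_sq:
  fixes x :: "real ^ 'n"
  shows "(norm (x + t *\<^sub>R axis i 1))\<^sup>2 = (norm x)\<^sup>2 + 2 * (x $ i) * t + t\<^sup>2"
  by (simp only: power2_norm_eq_inner)
    (simp add: inner_add_left inner_add_right inner_axis inner_axis' power2_eq_square algebra_simps)

lemma has_laplacian_norm_sq:
  fixes x :: "real ^ 'n"
  shows "has_laplacian (\<lambda>y. (norm (y - a))\<^sup>2) (2 * real CARD('n)) x"
proof -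
  have "(norm (x + t *\<^sub>R axis i 1 - a))\<^sup>2 = (norm (x - a))\<^sup>2 + (2 * ((x - a) $ i)) * t + 1 * t\<^sup>2" for t i
    using norm_axis_line_sq[of "x - a" t i] by (simp add: algebra_simps)
  then have "has_second_deriv0 (\<lambda>t. (norm (x + t *\<^sub>R axis i 1 - a))\<^sup>2) 2" for i
    using has_second_deriv0_quadratic[of "(norm (x - a))\<^sup>2" "2 * ((x - a) $ i)" 1] by simp
  then show ?thesis unfolding has_laplacian_def by (intro exI[of _ "\<lambda>i. 2"]) auto
qed

text \<open>The concave part of the barrier in \<open>harmonic_axis_difference_upper\<close>:
  \<open>CARD('n)\<close> copies of it cancel the Laplacian of the squared distance.\<close>

lemma has_laplacian_coord_quadratic:
  fixes x :: "real ^ 'n"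
  shows "has_laplacian (\<lambda>y. (y $ k - a) * (d - (y $ k - a))) (- 2) x"
proof -
  have *: "((x + t *\<^sub>R axis i 1) $ k - a) * (d - ((x + t *\<^sub>R axis i 1) $ k - a)) =
     (x $ k - a) * (d - (x $ k - a)) + (if i = k then d - 2 * (x $ k - a) else 0) * t
      + (if i = k then -1 else 0) * t\<^sup>2" for t i
    by (simp add: axis_def power2_eq_square algebra_simps)
  have "has_second_deriv0 (\<lambda>t. ((x + t *\<^sub>R axis i 1) $ k - a) * (d - ((x + t *\<^sub>R axis i 1) $ k - a)))
      (2 * (if i = k then -1 else 0))" for i
    unfolding * by (rule has_second_deriv0_quadratic)
  moreover have "(\<Sum>i\<in>UNIV. 2 * (if i = k then -1 else 0)) = (- 2 :: real)"
    by (simp add: if_distrib[of "\<lambda>x. 2 * x"] cong: if_cong)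
  ultimately show ?thesis unfolding has_laplacian_def
    by (intro exI[of _ "\<lambda>i. 2 * (if i = k then -1 else 0)"]) auto
qed

lemma has_laplacian_translate:
  "has_laplacian f L (x + h) \<Longrightarrow> has_laplacian (\<lambda>y. f (y + h)) L x"
  unfolding has_laplacian_def by (simp add: add_ac)

lemma has_laplacian_scale:
  assumes "has_laplacian f L (c *\<^sub>R x)"
  shows "has_laplacian (\<lambda>y. f (c *\<^sub>R y)) (c\<^sup>2 * L) x"
proof -
  from assms obtain D where D:
    "\<And>i. has_second_deriv0 (\<lambda>t. f (c *\<^sub>R x + t *\<^sub>R axis i 1)) (D i)" "(\<Sum>i\<in>UNIV. D i) = L"
    unfolding has_laplacian_def by blast
  have "has_second_deriv0 (\<lambda>t. f (c *\<^sub>R (x + t *\<^sub>R axis i 1))) (c\<^sup>2 * D i)" for i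
    using has_second_deriv0_scale[OF D(1)[of i], of c] by (simp add: scaleR_add_right)
  then show ?thesis unfolding has_laplacian_def
    using D(2) by (intro exI[of _ "\<lambda>i. c\<^sup>2 * D i"]) (auto simp: sum_distrib_left)
qed

definition reflect :: "'n \<Rightarrow> real \<Rightarrow> real ^ 'n \<Rightarrow> real ^ 'n" where
  "reflect k a y = y - (2 * (y $ k - a)) *\<^sub>R axis k 1"

text \<open>The reflection reverses the axis \<open>k\<close> alone, and the factor -1 on the
  parameter enters the second derivative squared.\<close>

lemma has_laplacian_reflect:
  assumes "has_laplacian f L (reflect k a x)"
  shows "has_laplacian (\<lambda>y. f (reflect k a y)) L x"
proof -
  from assms obtain D where D:
    "\<And>i. has_second_deriv0 (\<lambda>t. f (reflect k a x + t *\<^sub>R axis i 1)) (D i)" "(\<Sum>i\<in>UNIV. D i) = L"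
    unfolding has_laplacian_def by blast
  have "reflect k a (x + t *\<^sub>R axis i 1) =
      reflect k a x + ((if i = k then -1 else 1) * t) *\<^sub>R axis i 1" for i t
    by (auto simp: vec_eq_iff reflect_def axis_def algebra_simps)
  then have "has_second_deriv0 (\<lambda>t. f (reflect k a (x + t *\<^sub>R axis i 1))) (D i)" for i
    using has_second_deriv0_scale[OF D(1)[of i], of "if i = k then -1 else 1"] by auto
  then show ?thesis unfolding has_laplacian_def using D(2) by blast
qed

lemma has_laplacian_local_max:
  assumes "has_laplacian f L x" "r > 0" "\<And>y. y \<in> ball x r \<Longrightarrow> f y \<le> f x"
  shows "L \<le> 0"
proof -
  from assms(1) obtain D where D:
    "\<And>i. has_second_deriv0 (\<lambda>t. f (x + t *\<^sub>R axis i 1)) (D i)" "(\<Sum>i\<in>UNIV. D i) = L"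
    unfolding has_laplacian_def by blast
  have "D i \<le> 0" for i
    by (rule has_second_deriv0_local_max[OF D(1)[of i] assms(2)])
      (auto intro!: assms(3) simp: dist_norm)
  then have "(\<Sum>i\<in>UNIV. D i) \<le> 0" by (intro sum_nonpos)
  then show ?thesis using D(2) by simp
qed

section \<open>Maximum principle for local uniform limits of harmonic functions\<close>

text \<open>The radius is fixed before the accuracy \<eta>, because \<open>maximum_principle\<close>
  needs an accuracy that is small against the square of the radius. The notion covers functions
  built from first derivatives of \<open>u\<close>, for which no second derivatives are at
  hand.\<close>

definition locally_approx_harmonic :: "(real ^ 'n \<Rightarrow> real) \<Rightarrow> real ^ 'n \<Rightarrow> bool" where
  "locally_approx_harmonic f y \<longleftrightarrow>
     (\<exists>r>0. \<forall>\<eta>>0. \<exists>G. continuous_on (cball y r) G \<and>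
        (\<forall>x\<in>cball y r. \<bar>G x - f x\<bar> \<le> \<eta> \<and> has_laplacian G 0 x))"

text \<open>At a maximum point of \<open>f\<close> plus a small multiple of the squared norm,
  \<open>f\<close> is replaced by a nearby harmonic \<open>G\<close>, and half that multiple of the
  squared distance from the point is subtracted. The result has a maximum inside a small ball,
  although its Laplacian there is positive.\<close>

lemma maximum_principle:
  fixes f :: "real ^ 'n \<Rightarrow> real"
  assumes "compact K" "continuous_on K f"
    and alt: "\<And>y. y \<in> K \<Longrightarrow> f y \<le> 0 \<or> y \<in> interior K \<and> locally_approx_harmonic f y"
    and "x \<in> K"
  shows "f x \<le> 0"
proof (rule ccontr)
  assume "\<not> f x \<le> 0"
  then have m: "f x > 0" by simp
  from compact_imp_bounded[OF assms(1)] obtain B where B: "B > 0" "\<And>y. y \<in> K \<Longrightarrow> norm y \<le> B"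
    unfolding bounded_pos by blast
  \<comment> \<open>With this size the added term is at most \<open>f x / 2\<close> on
    \<open>K\<close>, so \<open>f\<close> is still positive at a maximum point \<open>p\<close> of
    \<open>g\<close>, which excludes the first alternative of \<open>alt\<close>.\<close>
  define e where "e = f x / (2 * B\<^sup>2)"
  have e: "e > 0" using m B by (simp add: e_def)
  have eB: "e * (norm y)\<^sup>2 \<le> f x / 2" if "y \<in> K" for y
  proof -
    have "(norm y)\<^sup>2 \<le> B\<^sup>2" using B(2)[OF that] by (simp add: power_mono)
    then have "e * (norm y)\<^sup>2 \<le> e * B\<^sup>2" using e by simp
    also have "\<dots> = f x / 2" using B(1) by (simp add: e_def field_simps)
    finally show ?thesis .
  qed
  define g where "g = (\<lambda>y. f y + e * (norm y)\<^sup>2)"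
  have "continuous_on K g" unfolding g_def by (intro continuous_intros assms(2))
  with continuous_attains_sup[OF assms(1)] \<open>x \<in> K\<close> obtain p where
    p: "p \<in> K" "\<And>y. y \<in> K \<Longrightarrow> g y \<le> g p" by blast
  have "f p > 0" using p(2)[OF \<open>x \<in> K\<close>] eB[OF p(1)] m e
    by (smt (verit, best) g_def field_sum_of_halves mult_nonneg_nonneg zero_le_power2)
  with alt[OF p(1)] have "p \<in> interior K" "locally_approx_harmonic f p" by auto
  then obtain r1 where r1: "r1 > 0" "\<And>\<eta>. \<eta> > 0 \<Longrightarrow> \<exists>G. continuous_on (cball p r1) G \<and>
        (\<forall>x\<in>cball p r1. \<bar>G x - f x\<bar> \<le> \<eta> \<and> has_laplacian G 0 x)"
    unfolding locally_approx_harmonic_def by blast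
  from \<open>p \<in> interior K\<close> obtain r2 where r2: "r2 > 0" "cball p r2 \<subseteq> K"
    unfolding mem_interior_cball by blast
  define r where "r = min r1 r2"
  have r: "r > 0" "cball p r \<subseteq> K" "cball p r \<subseteq> cball p r1"
    using r1(1) r2 by (auto simp: r_def)
  \<comment> \<open>On the sphere of radius \<open>r\<close> about \<open>p\<close> the term
    subtracted in \<open>F\<close> costs \<open>e / 2 * r\<^sup>2\<close>, more than the
    \<open>2 * \<eta>\<close> lost by replacing \<open>f\<close> with \<open>G\<close> at two
    points. So \<open>F\<close> has no maximum on the sphere.\<close>
  define \<eta> where "\<eta> = e * r\<^sup>2 / 8"
  have \<eta>: "\<eta> > 0" using e r by (simp add: \<eta>_def)
  from r1(2)[OF \<eta>] obtain G where G: "continuous_on (cball p r1) G"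
    "\<And>x. x \<in> cball p r1 \<Longrightarrow> \<bar>G x - f x\<bar> \<le> \<eta>" "\<And>x. x \<in> cball p r1 \<Longrightarrow> has_laplacian G 0 x"
    by blast
  define F where "F = (\<lambda>y. G y + (e * (norm (y - 0))\<^sup>2 - e / 2 * (norm (y - p))\<^sup>2))"
  have "continuous_on (cball p r) F" unfolding F_def
    by (intro continuous_intros continuous_on_subset[OF G(1)] r)
  from continuous_attains_sup[OF compact_cball _ this] r(1) obtain q where
    q: "q \<in> cball p r" "\<And>y. y \<in> cball p r \<Longrightarrow> F y \<le> F q" by auto
  have "dist p q \<noteq> r"
  proof
    assume d: "dist p q = r"
    have "F p \<le> F q" using q(2)[of p] r by simp
    moreover have "F q \<le> g q + \<eta> - e / 2 * r\<^sup>2"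
      using G(2)[of q] q(1) r(3) d unfolding F_def g_def by (auto simp: dist_norm norm_minus_commute)
    moreover have "F p \<ge> g p - \<eta>"
      using G(2)[of p] r1(1) unfolding F_def g_def by auto
    moreover have "g q \<le> g p" using p(2) q(1) r(2) by blast
    ultimately have "e / 2 * r\<^sup>2 \<le> 2 * \<eta>" by linarith
    then show False using \<eta> unfolding \<eta>_def by simp
  qed
  then have "dist p q < r" using q(1) by simp
  then obtain s where s: "s > 0" "ball q s \<subseteq> ball p r"
    by (meson centre_in_ball mem_ball open_ball openE)
  have "has_laplacian F (0 + (e * (2 * real CARD('n)) - e / 2 * (2 * real CARD('n)))) q"
    unfolding F_def
    by (intro has_laplacian_add has_laplacian_diff has_laplacian_cmult has_laplacian_norm_sq G(3))
      (use q(1) r(3) in blast)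
  then have "0 + (e * (2 * real CARD('n)) - e / 2 * (2 * real CARD('n))) \<le> 0"
    by (rule has_laplacian_local_max[OF _ s(1)]) (use q(2) s(2) ball_subset_cball in blast)
  then show False using e by (simp add: mult_le_0_iff)
qed

section \<open>Harmonic functions and estimates for their differences\<close>

text \<open>Continuity is a separate demand, since second derivatives along the axes do not imply
  it.\<close>

definition harmonic_on :: "(real ^ 'n) set \<Rightarrow> (real ^ 'n \<Rightarrow> real) \<Rightarrow> bool" where
  "harmonic_on S f \<longleftrightarrow> continuous_on S f \<and> (\<forall>x\<in>S. has_laplacian f 0 x)"

lemma harmonic_imp_locally_approx:
  assumes "harmonic_on S f" "open S" "x \<in> S"
  shows "locally_approx_harmonic f x"
proof -
  from assms(2,3) obtain r where r: "r > 0" "cball x r \<subseteq> S"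
    using open_contains_cball by blast
  then show ?thesis using assms(1) unfolding locally_approx_harmonic_def harmonic_on_def
    by (intro exI[of _ r] conjI allI impI exI[of _ f]) (auto intro: continuous_on_subset)
qed

lemma harmonic_on_subset: "harmonic_on S f \<Longrightarrow> T \<subseteq> S \<Longrightarrow> harmonic_on T f"
  unfolding harmonic_on_def by (auto intro: continuous_on_subset)

lemma harmonic_on_cmult: "harmonic_on S f \<Longrightarrow> harmonic_on S (\<lambda>y. c * f y)"
  unfolding harmonic_on_def using has_laplacian_cmult[of f 0]
  by (auto intro: continuous_intros)

lemma reflect_in_cball:
  fixes x y :: "real ^ 'n"
  assumes "y \<in> cball x d"
  shows "reflect k (x $ k) y \<in> cball x d"
proof -
  have "norm (x - reflect k (x $ k) y) = norm (x - y)"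
    unfolding norm_vec_def reflect_def
    by (rule arg_cong[of _ _ "\<lambda>f. L2_set f UNIV"]) (auto simp: fun_eq_iff axis_def abs_if)
  then show ?thesis using assms by (simp add: dist_norm)
qed

text \<open>On the half ball, half of the odd part of \<open>f\<close> under reflection is dominated by the harmonic
  function \<open>\<psi>\<close>, which is at least \<open>M\<close> on the sphere and nonnegative on the flat face.\<close>

lemma harmonic_axis_difference_upper:
  fixes f :: "real ^ 'n \<Rightarrow> real"
  assumes "harmonic_on S f" "open S" "cball x d \<subseteq> S" "d > 0"
    and M: "\<And>y. y \<in> cball x d \<Longrightarrow> \<bar>f y\<bar> \<le> M"
    and t: "0 \<le> t" "t \<le> d"
  shows "f (x + t *\<^sub>R axis k 1) - f (x - t *\<^sub>R axis k 1) \<le> 2 * real CARD('n) * M * t / d"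
proof -
  define N where "N = real CARD('n)"
  have N: "N \<ge> 1" unfolding N_def by (simp add: Suc_leI)
  have M0: "M \<ge> 0" using M[of x] assms(4) by (auto intro: order_trans[OF abs_ge_zero])
  define \<rho> where "\<rho> = reflect k (x $ k)"
  define K where "K = cball x d \<inter> {y. y $ k \<ge> x $ k}"
  \<comment> \<open>The two summands have Laplacians \<open>2 * N\<close> and
    \<open>- 2 * N\<close>. The second is nonnegative on the half ball, where
    \<open>y $ k - x $ k\<close> lies between 0 and \<open>d\<close>. On the axis \<psi> is of order
    \<open>t\<close>, which yields the linear bound.\<close>
  define \<psi> where "\<psi> = (\<lambda>y. M / d\<^sup>2 * ((norm (y - x))\<^sup>2 + N * ((y $ k - x $ k) * (d - (y $ k - x $ k)))))"
  define F where "F = (\<lambda>y. 1/2 * (f y - f (\<rho> y)) - \<psi> y)"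
  have cont\<rho>: "continuous_on T \<rho>" for T
    unfolding \<rho>_def reflect_def by (intro continuous_intros)
  have \<rho>ball: "\<rho> ` cball x d \<subseteq> cball x d"
    unfolding \<rho>_def using reflect_in_cball by blast
  have contf: "continuous_on (cball x d) f"
    using assms(1,3) unfolding harmonic_on_def by (auto intro: continuous_on_subset)
  have contF: "continuous_on (cball x d) F"
    unfolding F_def \<psi>_def
    by (intro continuous_intros contf continuous_on_compose2[OF contf cont\<rho>]  \<rho>ball)
  have lapF: "has_laplacian F 0 y" if "y \<in> cball x d" for y
  proof -
    have "has_laplacian F (1/2 * (0 - 0) - M / d\<^sup>2 * (2 * N + N * (- 2))) y"
      unfolding F_def \<psi>_def N_def
      by (intro has_laplacian_add has_laplacian_diff has_laplacian_cmult has_laplacian_norm_sq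
          has_laplacian_coord_quadratic has_laplacian_reflect[of f 0 k "x $ k" y, folded \<rho>_def])
        (use that \<rho>ball assms(1,3) in \<open>auto simp: harmonic_on_def image_subset_iff subset_iff\<close>)
    then show ?thesis by simp
  qed
  have harmF: "harmonic_on (ball x d \<inter> {y. y $ k > x $ k}) F"
    unfolding harmonic_on_def using contF lapF by (auto intro: continuous_on_subset)
  have openU: "open (ball x d \<inter> {y. y $ k > x $ k})"
    by (intro open_Int open_ball open_halfspace_component_gt_cart)
  have *: "F y \<le> 0" if "y \<in> K" for y
  proof (rule maximum_principle[OF _ _ _ that])
    show "compact K" unfolding K_def
      by (intro compact_Int_closed compact_cball closed_halfspace_component_ge_cart)
    show "continuous_on K F" using contF unfolding K_def by (auto intro: continuous_on_subset)
    fix y assume y: "y \<in> K"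
    have sd: "0 \<le> y $ k - x $ k" "y $ k - x $ k \<le> d"
      using y component_le_norm_cart[of "y - x" k]
      by (auto simp: K_def dist_norm norm_minus_commute)
    have psi0: "N * ((y $ k - x $ k) * (d - (y $ k - x $ k))) \<ge> 0"
      using sd N by (intro mult_nonneg_nonneg) auto
    consider "y $ k = x $ k" | "dist x y = d" | "y \<in> ball x d \<inter> {y. y $ k > x $ k}"
      using y unfolding K_def by fastforce
    then show "F y \<le> 0 \<or> y \<in> interior K \<and> locally_approx_harmonic F y"
    proof cases
      case 1
      then have "\<rho> y = y" unfolding \<rho>_def reflect_def by simp
      moreover have "\<psi> y \<ge> 0" unfolding \<psi>_def using M0 psi0 by (intro mult_nonneg_nonneg) auto
      ultimately show ?thesis unfolding F_def by simp
    next
      case 2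
      have "M = M / d\<^sup>2 * d\<^sup>2" using assms(4) by simp
      also have "\<dots> \<le> \<psi> y" unfolding \<psi>_def using M0 psi0 2
        by (intro mult_left_mono) (auto simp: dist_norm norm_minus_commute)
      finally have "M \<le> \<psi> y" .
      moreover have "\<bar>f y\<bar> \<le> M" "\<bar>f (\<rho> y)\<bar> \<le> M"
        using y \<rho>ball by (auto intro!: M simp: K_def image_subset_iff)
      ultimately have "f y - f (\<rho> y) \<le> 2 * \<psi> y" by linarith
      then have "F y \<le> 0" unfolding F_def by simp
      then show ?thesis ..
    next
      case 3
      have "ball x d \<inter> {y. y $ k > x $ k} \<subseteq> interior K"
        by (rule interior_maximal[OF _ openU]) (auto simp: K_def)
      then show ?thesis using 3 harmonic_imp_locally_approx[OF harmF openU 3] by blast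
    qed
  qed
  define y where "y = x + t *\<^sub>R axis k 1"
  have "y \<in> K" using t by (auto simp: y_def K_def dist_norm)
  have "\<rho> y = x - t *\<^sub>R axis k 1"
    by (auto simp: \<rho>_def reflect_def y_def axis_def vec_eq_iff)
  moreover have "\<psi> y \<le> N * M * t / d"
  proof -
    have "\<psi> y = M / d\<^sup>2 * (t\<^sup>2 + N * (t * (d - t)))" unfolding \<psi>_def y_def by simp
    also have "\<dots> \<le> M / d\<^sup>2 * (N * t * d)"
    proof (rule mult_left_mono)
      have "t\<^sup>2 \<le> N * t\<^sup>2" using N mult_right_mono[of 1 N "t\<^sup>2"] by simp
      then show "t\<^sup>2 + N * (t * (d - t)) \<le> N * t * d"
        by (simp add: algebra_simps power2_eq_square)
    qed (use M0 in auto)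
    also have "\<dots> = N * M * t / d" using assms(4) by (simp add: power2_eq_square)
    finally show ?thesis .
  qed
  ultimately have "f (x + t *\<^sub>R axis k 1) - f (x - t *\<^sub>R axis k 1) \<le> 2 * (N * M * t / d)"
    using *[OF \<open>y \<in> K\<close>] unfolding F_def y_def by simp
  then show ?thesis unfolding N_def by simp
qed

lemma harmonic_axis_difference:
  fixes f :: "real ^ 'n \<Rightarrow> real"
  assumes "harmonic_on S f" "open S" "cball x d \<subseteq> S" "d > 0"
    and M: "\<And>y. y \<in> cball x d \<Longrightarrow> \<bar>f y\<bar> \<le> M"
    and t: "\<bar>t\<bar> \<le> d"
  shows "\<bar>f (x + t *\<^sub>R axis k 1) - f (x - t *\<^sub>R axis k 1)\<bar> \<le> 2 * real CARD('n) * M * \<bar>t\<bar> / d"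
proof -
  have "f (x + \<bar>t\<bar> *\<^sub>R axis k 1) - f (x - \<bar>t\<bar> *\<^sub>R axis k 1) \<le> 2 * real CARD('n) * M * \<bar>t\<bar> / d"
    using harmonic_axis_difference_upper[OF assms(1-4) M, where t = "\<bar>t\<bar>"] t by simp
  moreover have "- f (x + \<bar>t\<bar> *\<^sub>R axis k 1) + f (x - \<bar>t\<bar> *\<^sub>R axis k 1) \<le> 2 * real CARD('n) * M * \<bar>t\<bar> / d"
    using harmonic_axis_difference_upper[OF harmonic_on_cmult[OF assms(1), of "-1"] assms(2-4),
        where t = "\<bar>t\<bar>" and M = M] t M by simp
  ultimately show ?thesis by (cases "t \<ge> 0") auto
qed

text \<open>The point moves from \<open>x\<close> to \<open>x + h\<close> one coordinate at a time.
  Each move is a difference symmetric about its midpoint, so \<open>harmonic_axis_difference\<close>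
  applies to it.\<close>

lemma harmonic_lipschitz:
  fixes f :: "real ^ 'n \<Rightarrow> real"
  assumes f: "harmonic_on (ball 0 R) f" and M: "\<And>y. y \<in> ball 0 R \<Longrightarrow> \<bar>f y\<bar> \<le> M"
    and "R' < R" "norm x + norm h < R'"
  shows "\<bar>f (x + h) - f x\<bar> \<le> 2 * (real CARD('n))\<^sup>2 / (R - R') * M * norm h"
proof -
  define N where "N = real CARD('n)"
  have N: "N \<ge> 1" unfolding N_def by (simp add: Suc_leI)
  \<comment> \<open>Half of the gap, so that closed balls of radius \<open>d\<close> about points of
    norm below \<open>R'\<close> stay inside the open ball of radius \<open>R\<close>.\<close>
  define d where "d = (R - R') / 2"
  have d: "d > 0" using assms by (simp add: d_def)
  have "norm x < R" using assms norm_ge_zero[of h] by linarith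
  then have M0: "M \<ge> 0" using M[of x] by auto
  define p where "p = (\<lambda>A. x + (\<chi> i. if i \<in> A then h $ i else 0))"
  have close: "norm y < R'" if "\<And>i. \<bar>(y - x) $ i\<bar> \<le> \<bar>h $ i\<bar>" for y
  proof -
    have "norm (y - x) \<le> norm h" using that by (intro norm_le_componentwise_cart) auto
    then show ?thesis using assms(4) norm_triangle_sub[of y x] by linarith
  qed
  have "\<bar>f (p A) - f x\<bar> \<le> N * M / d * (\<Sum>i\<in>A. \<bar>h $ i\<bar>)" for A
  proof (induction A rule: finite_induct[OF finite])
    case 1
    then show ?case by (simp add: p_def vec_eq_iff[symmetric] flip: zero_vec_def)
  next
    case (2 k A)
    define c where "c = p A + (h $ k / 2) *\<^sub>R axis k 1"
    have c1: "c + (h $ k / 2) *\<^sub>R axis k 1 = p (insert k A)"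
      using 2 by (auto simp: c_def p_def vec_eq_iff axis_def)
    have c2: "c - (h $ k / 2) *\<^sub>R axis k 1 = p A" by (simp add: c_def)
    have "norm c < R'" using 2 by (intro close) (auto simp: c_def p_def axis_def)
    then have sub: "cball c d \<subseteq> ball 0 R"
      using d by (intro subsetI) (auto simp: d_def dist_norm field_simps intro: le_less_trans[OF norm_triangle_sub[of _ c]] simp: norm_minus_commute)
    have R: "R' \<le> R" using assms by simp
    have "\<bar>f (p (insert k A)) - f (p A)\<bar> \<le> N * M / d * \<bar>h $ k\<bar>"
    proof (cases "\<bar>h $ k / 2\<bar> \<le> d")
      case True
      from harmonic_axis_difference[OF f open_ball sub d _ this, of M k] M sub
      show ?thesis unfolding c1 c2 N_def by (simp add: subset_iff)
    next
      \<comment> \<open>A move too long for the axis estimate has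
        \<open>\<bar>h $ k\<bar> / d\<close> above 2, so the trivial bound \<open>2 * M\<close> is
        good enough.\<close>
      case False
      have "norm (p (insert k A)) < R'" "norm (p A) < R'" by (rule close; simp add: p_def)+
      then have "\<bar>f (p (insert k A))\<bar> \<le> M" "\<bar>f (p A)\<bar> \<le> M" using R by (auto intro!: M)
      then have "\<bar>f (p (insert k A)) - f (p A)\<bar> \<le> M * 2" by linarith
      also have "\<dots> \<le> M * (N * (\<bar>h $ k\<bar> / d))"
      proof (rule mult_left_mono[OF _ M0])
        have "2 \<le> \<bar>h $ k\<bar> / d" using False d by (simp add: field_simps)
        with N mult_mono[of 1 N 2 "\<bar>h $ k\<bar> / d"] show "2 \<le> N * (\<bar>h $ k\<bar> / d)" by simp
      qed
      finally show ?thesis by (simp add: mult_ac)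
    qed
    moreover have "N * M / d * (\<Sum>i\<in>insert k A. \<bar>h $ i\<bar>)
        = N * M / d * \<bar>h $ k\<bar> + N * M / d * (\<Sum>i\<in>A. \<bar>h $ i\<bar>)"
      using 2 by (simp add: algebra_simps add_divide_distrib)
    ultimately show ?case using 2 by linarith
  qed
  from this[of UNIV] have "\<bar>f (x + h) - f x\<bar> \<le> N * M / d * (\<Sum>i\<in>UNIV. \<bar>h $ i\<bar>)"
    by (simp add: p_def)
  also have "\<dots> \<le> N * M / d * (N * norm h)"
  proof (rule mult_left_mono)
    show "(\<Sum>i\<in>UNIV. \<bar>h $ i\<bar>) \<le> N * norm h"
      using sum_bounded_above[of UNIV "\<lambda>i. \<bar>h $ i\<bar>" "norm h"] component_le_norm_cart[of h]
      by (simp add: N_def)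
  qed (use N M0 d in auto)
  also have "\<dots> = 2 * N\<^sup>2 / (R - R') * M * norm h"
    using d unfolding d_def by (simp add: power2_eq_square field_simps)
  finally show ?thesis unfolding N_def .
qed

section \<open>Iterated differences and homogeneous harmonic functions\<close>

definition fdiff :: "'a::ab_group_add \<Rightarrow> ('a \<Rightarrow> real) \<Rightarrow> 'a \<Rightarrow> real" where
  "fdiff h f = (\<lambda>x. f (x + h) - f x)"

text \<open>The \<open>k\<close>-th difference is a fixed linear combination of the values at the
  points \<open>x + real j *\<^sub>R h\<close> with \<open>j \<le> k\<close>. The two spaces may
  differ, which lets differences along a ray be compared with differences of a power of a real
  variable.\<close>

lemma fdiff_funpow_transfer:
  fixes x h :: "'a::real_vector" and y h' :: "'b::real_vector"
  assumes "\<And>j. j \<le> k \<Longrightarrow> f (x + real j *\<^sub>R h) = c * g (y + real j *\<^sub>R h')"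
  shows "(fdiff h ^^ k) f x = c * (fdiff h' ^^ k) g y"
  using assms
proof (induction k arbitrary: x y)
  case 0
  then show ?case using 0[of 0] by simp
next
  case (Suc k)
  have "(fdiff h ^^ k) f x = c * (fdiff h' ^^ k) g y"
    using Suc.prems by (intro Suc.IH) auto
  moreover have "(fdiff h ^^ k) f (x + h) = c * (fdiff h' ^^ k) g (y + h')"
  proof (rule Suc.IH)
    fix j assume "j \<le> k"
    then show "f (x + h + real j *\<^sub>R h) = c * g (y + h' + real j *\<^sub>R h')"
      using Suc.prems[of "Suc j"] by (simp add: scaleR_add_left add_ac)
  qed
  ultimately show ?case by (simp add: fdiff_def[of _ "(fdiff _ ^^ k) _"] right_diff_distrib)
qed

lemma fdiff_funpow_has_derivative:
  fixes h :: real
  assumes "h \<ge> 0" "\<And>t. t > 0 \<Longrightarrow> (f has_real_derivative f' t) (at t)" "t > 0"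
  shows "((fdiff h ^^ k) f has_real_derivative (fdiff h ^^ k) f' t) (at t)"
  using assms(3)
proof (induction k arbitrary: t)
  case 0
  then show ?case using assms by simp
next
  case (Suc k)
  have "((\<lambda>x. (fdiff h ^^ k) f (x + h)) has_real_derivative (fdiff h ^^ k) f' (t + h)) (at t)"
    using Suc.IH[of "t + h"] Suc.prems assms(1) by (simp add: DERIV_shift)
  then have "((\<lambda>x. (fdiff h ^^ k) f (x + h) - (fdiff h ^^ k) f x) has_real_derivative
      (fdiff h ^^ k) f' (t + h) - (fdiff h ^^ k) f' t) (at t)"
    using Suc by (intro DERIV_diff) auto
  then show ?case by (simp add: fdiff_def[of _ "(fdiff _ ^^ k) _"])
qed

text \<open>By the mean value theorem, one difference of the iterate for exponent \<open>s\<close>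
  is \<open>s\<close> times the iterate for exponent \<open>s - 1\<close> at a later point. The
  falling factorial gains the same factor \<open>s\<close>, so the product gains
  \<open>s\<^sup>2\<close>. No factor vanishes, as \<open>s\<close> is not a natural number.\<close>

lemma fdiff_funpow_powr_sign:
  assumes "s \<notin> \<nat>" "t > 0"
  shows "(\<Prod>j<k. s - real j) * (fdiff 1 ^^ k) (\<lambda>t. t powr s) t > 0"
  using assms
proof (induction k arbitrary: s t)
  case 0
  then show ?case by simp
next
  case (Suc k)
  have s1: "s - 1 \<notin> \<nat>"
    using Suc.prems(1) Nats_add[OF _ Nats_1, of "s - 1"] by auto
  have s0: "s \<noteq> 0" using Suc.prems by auto
  let ?f = "(fdiff 1 ^^ k) (\<lambda>t. t powr s)"
  have d: "(?f has_real_derivative s * (fdiff 1 ^^ k) (\<lambda>t. t powr (s - 1)) x) (at x)" if "x > 0" for x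
  proof -
    have "(?f has_real_derivative (fdiff 1 ^^ k) (\<lambda>t. s * t powr (s - 1)) x) (at x)"
      using that by (intro fdiff_funpow_has_derivative) (auto intro!: derivative_eq_intros)
    also have "(fdiff 1 ^^ k) (\<lambda>t. s * t powr (s - 1)) x = s * (fdiff 1 ^^ k) (\<lambda>t. t powr (s - 1)) x"
      by (rule fdiff_funpow_transfer) simp
    finally show ?thesis .
  qed
  obtain z where z: "z > t" "?f (t + 1) - ?f t = (t + 1 - t) * (s * (fdiff 1 ^^ k) (\<lambda>t. t powr (s - 1)) z)"
    using MVT2[of t "t + 1" ?f, OF _ d] Suc.prems(2) by auto
  \<comment> \<open>The first factor is split off, so that the rest is the falling factorial of
    \<open>s - 1\<close> from the induction hypothesis.\<close>
  have "(\<Prod>j<Suc k. s - real j) = s * (\<Prod>j<k. (s - 1) - real j)"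
    by (simp add: prod.lessThan_Suc_shift diff_diff_eq del: prod.lessThan_Suc)
  then have "(\<Prod>j<Suc k. s - real j) * (fdiff 1 ^^ Suc k) (\<lambda>t. t powr s) t =
      s\<^sup>2 * ((\<Prod>j<k. (s - 1) - real j) * (fdiff 1 ^^ k) (\<lambda>t. t powr (s - 1)) z)"
    using z(2) by (simp add: fdiff_def power2_eq_square mult_ac)
  moreover have "(\<Prod>j<k. (s - 1) - real j) * (fdiff 1 ^^ k) (\<lambda>t. t powr (s - 1)) z > 0"
    using Suc.prems(2) z(1) by (intro Suc.IH s1) auto
  ultimately show ?case using s0 by simp
qed

lemma harmonic_on_fdiff_funpow:
  fixes f :: "real ^ 'n \<Rightarrow> real"
  assumes "harmonic_on (ball 0 R) f"
  shows "harmonic_on (ball 0 (R - real k * norm h)) ((fdiff h ^^ k) f)"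
proof (induction k)
  case 0
  then show ?case using assms by simp
next
  case (Suc k)
  let ?g = "(fdiff h ^^ k) f" and ?B = "ball (0 :: real ^ 'n) (R - real (Suc k) * norm h)"
  have sub: "?B \<subseteq> ball 0 (R - real k * norm h)"
    by (intro subset_ball) (simp add: mult_right_mono)
  have sub': "(\<lambda>x. x + h) ` ?B \<subseteq> ball 0 (R - real k * norm h)"
  proof
    fix y assume "y \<in> (\<lambda>x. x + h) ` ?B"
    then obtain x where x: "y = x + h" "norm x < R - real (Suc k) * norm h" by auto
    then show "y \<in> ball 0 (R - real k * norm h)"
      using norm_triangle_ineq[of x h] by (simp add: algebra_simps)
  qed
  have "continuous_on ?B (\<lambda>x. ?g (x + h) - ?g x)"
  proof -
    have c: "continuous_on (ball 0 (R - real k * norm h)) ?g"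
      using Suc by (simp add: harmonic_on_def)
    have "continuous_on ?B (\<lambda>x. ?g (x + h))"
      by (rule continuous_on_compose2[OF c _ sub']) (intro continuous_intros)
    then show ?thesis by (rule continuous_on_diff[OF _ continuous_on_subset[OF c sub]])
  qed
  moreover have "has_laplacian (\<lambda>x. ?g (x + h) - ?g x) (0 - 0) x" if "x \<in> ?B" for x
  proof -
    have "has_laplacian ?g 0 (x + h)" "has_laplacian ?g 0 x"
      using Suc that sub sub' unfolding harmonic_on_def by (blast, blast)
    then show ?thesis by (intro has_laplacian_diff has_laplacian_translate)
  qed
  ultimately show ?case unfolding harmonic_on_def by (simp add: fdiff_def)
qed

text \<open>Each further difference gains a factor \<open>norm h\<close> by
  \<open>harmonic_lipschitz\<close>, at the price of a slightly smaller ball. This replaces interior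
  estimates for higher derivatives.\<close>

lemma harmonic_fdiff_bound:
  fixes f :: "real ^ 'n \<Rightarrow> real"
  assumes f: "harmonic_on (ball 0 R) f" and M: "\<And>y. y \<in> ball 0 R \<Longrightarrow> \<bar>f y\<bar> \<le> M"
    and "R' < R"
  shows "\<exists>C. \<forall>h x. norm x + real k * norm h < R' \<longrightarrow> \<bar>(fdiff h ^^ k) f x\<bar> \<le> C * norm h ^ k"
  using assms(3)
proof (induction k arbitrary: R')
  case 0
  then show ?case using M by (intro exI[of _ M]) auto
next
  case (Suc k)
  define R1 where "R1 = (R + R') / 2"
  have R1: "R' < R1" "R1 < R" using Suc.prems by (auto simp: R1_def)
  from Suc.IH[OF R1(2)] obtain C where
    C: "\<And>h x. norm x + real k * norm h < R1 \<Longrightarrow> \<bar>(fdiff h ^^ k) f x\<bar> \<le> C * norm h ^ k" by blast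
  define L where "L = 2 * (real CARD('n))\<^sup>2 / (R1 - R')"
  have "\<bar>(fdiff h ^^ Suc k) f x\<bar> \<le> (L * C) * norm h ^ Suc k"
    if x: "norm x + real (Suc k) * norm h < R'" for h x
  proof -
    \<comment> \<open>Both radii shrink by \<open>real k * norm h\<close>, so their gap
      \<open>R1 - R'\<close>, and with it the constant, is independent of \<open>h\<close>.\<close>
    have "\<bar>(fdiff h ^^ k) f (x + h) - (fdiff h ^^ k) f x\<bar> \<le>
        2 * (real CARD('n))\<^sup>2 / ((R1 - real k * norm h) - (R' - real k * norm h)) * (C * norm h ^ k) * norm h"
    proof (rule harmonic_lipschitz)
      show "harmonic_on (ball 0 (R1 - real k * norm h)) ((fdiff h ^^ k) f)"
        using f R1 by (intro harmonic_on_fdiff_funpow) (auto intro: harmonic_on_subset)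
      show "\<bar>(fdiff h ^^ k) f y\<bar> \<le> C * norm h ^ k" if "y \<in> ball 0 (R1 - real k * norm h)" for y
        using that by (intro C) auto
      show "norm x + norm h < R' - real k * norm h" using x by (simp add: algebra_simps)
    qed (use R1 in simp)
    then show ?thesis by (simp add: L_def fdiff_def mult_ac)
  qed
  then show ?case by blast
qed

text \<open>The \<open>k\<close>-th difference of \<open>f\<close> with step \<open>\<lambda> e\<close> at \<open>\<lambda> e\<close> equals \<open>\<lambda> powr s\<close> times a nonzero
  multiple of \<open>f e\<close>, while it is \<open>O(\<lambda> ^ k)\<close>; take \<open>k > s\<close>.\<close>

lemma homogeneous_harmonic_zero:
  fixes f :: "real ^ 'n \<Rightarrow> real"
  assumes f: "harmonic_on (ball 0 R) f" and M: "\<And>y. y \<in> ball 0 R \<Longrightarrow> \<bar>f y\<bar> \<le> M"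
    and hom: "\<And>x t. x \<in> ball 0 R \<Longrightarrow> 0 < t \<Longrightarrow> t \<le> 1 \<Longrightarrow> f (t *\<^sub>R x) = t powr s * f x"
    and "s \<notin> \<nat>" "R > 0"
  shows "\<exists>r>0. \<forall>x\<in>ball 0 r. f x = 0"
proof -
  obtain k where k: "real k > s" using reals_Archimedean2 by blast
  from harmonic_fdiff_bound[OF f M, of "R / 2" k] \<open>R > 0\<close> obtain C where
    C: "\<And>h x. norm x + real k * norm h < R / 2 \<Longrightarrow> \<bar>(fdiff h ^^ k) f x\<bar> \<le> C * norm h ^ k"
    by auto
  \<comment> \<open>For \<open>norm e < r\<close> all points \<open>e + real j *\<^sub>R e\<close>
    with \<open>j \<le> k\<close> have norm below \<open>R / 2\<close>, within reach of the bound
    with \<open>C\<close>.\<close>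
  define r where "r = R / 2 / (real k + 1)"
  have r: "r > 0" using \<open>R > 0\<close> by (simp add: r_def)
  have "f e = 0" if "e \<in> ball 0 r" for e
  proof -
    have e: "norm e + real k * norm e < R / 2" using that by (simp add: r_def field_simps)
    have inR: "e + real j *\<^sub>R e \<in> ball 0 R" if "j \<le> k" for j
    proof -
      have "norm (e + real j *\<^sub>R e) \<le> norm e + real j * norm e"
        by (rule order_trans[OF norm_triangle_ineq]) simp
      also have "\<dots> \<le> norm e + real k * norm e" using that by (simp add: mult_right_mono)
      finally show ?thesis using e \<open>R > 0\<close> by simp
    qed
    define P where "P = (fdiff 1 ^^ k) (\<lambda>t. t powr s) 1"
    have "P \<noteq> 0" using fdiff_funpow_powr_sign[OF \<open>s \<notin> \<nat>\<close>, of 1 k] by (auto simp: P_def)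
    have 1: "(fdiff e ^^ k) f e = f e * P" unfolding P_def
    proof (rule fdiff_funpow_transfer)
      fix j assume "j \<le> k"
      define t where "t = 1 + real j"
      have t: "t \<ge> 1" by (simp add: t_def)
      have te: "e + real j *\<^sub>R e = t *\<^sub>R e" by (simp add: t_def scaleR_add_left)
      \<comment> \<open>Homogeneity is assumed only for factors at most 1, so it is applied at
        \<open>t *\<^sub>R e\<close> with the factor \<open>1 / t\<close>.\<close>
      have "f ((1 / t) *\<^sub>R (t *\<^sub>R e)) = (1 / t) powr s * f (t *\<^sub>R e)"
        using inR[OF \<open>j \<le> k\<close>] t unfolding te by (intro hom) auto
      then have "f e = f (t *\<^sub>R e) / t powr s" using t by (simp add: powr_divide)
      then show "f (e + real j *\<^sub>R e) = f e * (1 + real j *\<^sub>R 1) powr s"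
        using t unfolding te by (simp add: t_def)
    qed
    have bound: "\<bar>f e * P\<bar> \<le> C * norm e ^ k * l powr (real k - s)" if l: "0 < l" "l < 1" for l
    proof -
      have "(fdiff (l *\<^sub>R e) ^^ k) f (l *\<^sub>R e) = l powr s * (fdiff e ^^ k) f e"
      proof (rule fdiff_funpow_transfer)
        fix j assume "j \<le> k"
        have "l *\<^sub>R e + real j *\<^sub>R l *\<^sub>R e = l *\<^sub>R (e + real j *\<^sub>R e)"
          by (simp add: scaleR_add_right mult.commute)
        then show "f (l *\<^sub>R e + real j *\<^sub>R l *\<^sub>R e) = l powr s * f (e + real j *\<^sub>R e)"
          using hom[OF inR[OF \<open>j \<le> k\<close>]] l by simp
      qed
      moreover have "\<bar>(fdiff (l *\<^sub>R e) ^^ k) f (l *\<^sub>R e)\<bar> \<le> C * norm (l *\<^sub>R e) ^ k"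
      proof (rule C)
        have "norm (l *\<^sub>R e) + real k * norm (l *\<^sub>R e) = l * (norm e + real k * norm e)"
          using l by (simp add: algebra_simps)
        also have "\<dots> \<le> norm e + real k * norm e" using l by (intro mult_left_le_one_le) auto
        finally show "norm (l *\<^sub>R e) + real k * norm (l *\<^sub>R e) < R / 2" using e by simp
      qed
      ultimately have "l powr s * \<bar>f e * P\<bar> \<le> C * norm e ^ k * l ^ k"
        using l unfolding 1 by (simp add: abs_mult power_mult_distrib mult_ac)
      then show ?thesis using l
        by (simp add: powr_diff powr_realpow field_simps)
    qed
    \<comment> \<open>The left side of \<open>bound\<close> does not depend on \<open>l\<close>, and
      the right side tends to 0 because \<open>k > s\<close>.\<close>
    have "((\<lambda>l. C * norm e ^ k * l powr (real k - s)) \<longlongrightarrow> C * norm e ^ k * 0 powr (real k - s)) (at_right 0)"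
      using k by (intro tendsto_intros) (auto simp: eventually_at_right_less less_imp_le intro: eventually_mono[OF eventually_at_right_less])
    moreover have "\<forall>\<^sub>F l in at_right (0::real). \<bar>f e * P\<bar> \<le> C * norm e ^ k * l powr (real k - s)"
      by (rule eventually_at_rightI[of 0 1]) (use bound in auto)
    ultimately have "\<bar>f e * P\<bar> \<le> C * norm e ^ k * 0 powr (real k - s)"
      by (intro tendsto_lowerbound[of _ _ "at_right 0"]) auto
    then show ?thesis using \<open>P \<noteq> 0\<close> by simp
  qed
  then show ?thesis using r by blast
qed

section \<open>Powers of the norm\<close>

lemma abs_powr_has_derivative_zero:
  fixes p t :: real
  assumes "p > 1"
  shows "((\<lambda>s. \<bar>s - t\<bar> powr p) has_real_derivative 0) (at t)"
proof -
  have "((\<lambda>h::real. \<bar>h\<bar> powr (p - 1)) \<longlongrightarrow> \<bar>0\<bar> powr (p - 1)) (at 0)"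
    using assms by (intro tendsto_intros) auto
  then have *: "((\<lambda>h::real. \<bar>h\<bar> powr (p - 1)) \<longlongrightarrow> 0) (at 0)" by simp
  have "\<bar>(\<bar>h\<bar> powr p) / h\<bar> = \<bar>h\<bar> powr (p - 1)" if "h \<noteq> 0" for h :: real
    using that by (simp add: powr_diff)
  then have "\<forall>\<^sub>F h in at (0::real). \<bar>h\<bar> powr (p - 1) = \<bar>(\<bar>h\<bar> powr p) / h\<bar>"
    by (auto simp: eventually_at_filter)
  then have "((\<lambda>h::real. \<bar>(\<bar>h\<bar> powr p) / h\<bar>) \<longlongrightarrow> 0) (at 0)"
    using * tendsto_cong by force
  then show ?thesis unfolding DERIV_def by (subst (asm) tendsto_rabs_zero_iff) simp
qed

text \<open>Away from the origin the norm power is the \<open>p / 2\<close>-th power of a positive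
  quadratic in the parameter. At the origin the formula gives 0, which is the derivative when
  \<open>p > 1\<close>. The second alternative admits the exponent \<open>p - 2\<close> when the
  derivative is differentiated again.\<close>

lemma norm_powr_axis_derivative:
  fixes x :: "real ^ 'n"
  assumes "p > 1 \<or> x + t *\<^sub>R axis i 1 \<noteq> 0"
  shows "((\<lambda>s. norm (x + s *\<^sub>R axis i 1) powr p) has_real_derivative
     p * norm (x + t *\<^sub>R axis i 1) powr (p - 2) * (x $ i + t)) (at t)"
proof (cases "x + t *\<^sub>R axis i 1 = 0")
  case True
  then have "x = (- t) *\<^sub>R axis i 1" by (simp add: eq_neg_iff_add_eq_0)
  then have "x + s *\<^sub>R axis i 1 = (s - t) *\<^sub>R axis i 1" for s
    by (simp add: scaleR_diff_left)
  then have "norm (x + s *\<^sub>R axis i 1) = \<bar>s - t\<bar>" for s by simp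
  then show ?thesis using True assms abs_powr_has_derivative_zero[of p t] by simp
next
  case False
  define q where "q = (\<lambda>s. (norm x)\<^sup>2 + 2 * (x $ i) * s + s\<^sup>2)"
  have q: "q s = (norm (x + s *\<^sub>R axis i 1))\<^sup>2" for s by (simp add: q_def norm_axis_line_sq)
  have pw: "q s powr (a / 2) = norm (x + s *\<^sub>R axis i 1) powr a" for s a
    unfolding q by (cases "x + s *\<^sub>R axis i 1 = 0") (simp_all add: powr_powr flip: powr_numeral)
  have "(q has_real_derivative 2 * (x $ i + t)) (at t)"
    unfolding q_def by (auto intro!: derivative_eq_intros)
  moreover have "q t > 0" using False by (simp add: q)
  ultimately have "((\<lambda>s. q s powr (p / 2)) has_real_derivative
      (p / 2 * q t powr (p / 2 - 1)) * (2 * (x $ i + t))) (at t)"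
    by (intro DERIV_chain2[OF has_real_derivative_powr])
  moreover have "q t powr (p / 2 - 1) = norm (x + t *\<^sub>R axis i 1) powr (p - 2)"
    using pw[of t "p - 2"] by (simp add: diff_divide_distrib)
  moreover have "(p / 2 * a) * (2 * b) = p * a * b" for a b by simp
  ultimately show ?thesis unfolding pw by metis
qed

lemma has_laplacian_norm_powr:
  fixes x :: "real ^ 'n"
  assumes "p \<ge> 2"
  shows "has_laplacian (\<lambda>y. norm y powr p) (p * (p - 2 + real CARD('n)) * radial_power (p - 2) x) x"
proof -
  define g where "g = (\<lambda>i t. p * norm (x + t *\<^sub>R axis i 1) powr (p - 2) * (x $ i + t))"
  have g: "((\<lambda>s. norm (x + s *\<^sub>R axis i 1) powr p) has_real_derivative g i t) (at t)" for i t
    unfolding g_def using assms by (intro norm_powr_axis_derivative) auto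
  have "\<exists>D. (\<forall>i. (g i has_real_derivative D i) (at 0)) \<and>
      (\<Sum>i\<in>UNIV. D i) = p * (p - 2 + real CARD('n)) * radial_power (p - 2) x"
  \<comment> \<open>At the origin the formula for the second derivative breaks down: for
    \<open>p = 2\<close> each \<open>g i\<close> is linear with slope 2, and for
    \<open>p > 2\<close> its difference quotient tends to 0. \<open>radial_power\<close> takes the
    matching values 1 and 0.\<close>
  proof (cases "x = 0")
    case x: True
    show ?thesis
    proof (cases "p = 2")
      case True
      have "g i = (\<lambda>t. 2 * t)" for i
        by (rule ext) (auto simp: g_def x True)
      then have "(g i has_real_derivative 2) (at 0)" for i
        by (auto intro!: derivative_eq_intros)
      then show ?thesis
        by (intro exI[of _ "\<lambda>i. 2"]) (auto simp: True radial_power_def)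
    next
      case False
      have "((\<lambda>h::real. p * \<bar>h\<bar> powr (p - 2)) \<longlongrightarrow> p * \<bar>0\<bar> powr (p - 2)) (at 0)"
        using assms False by (intro tendsto_intros) auto
      then have *: "((\<lambda>h::real. p * \<bar>h\<bar> powr (p - 2)) \<longlongrightarrow> 0) (at 0)" by simp
      have "\<forall>\<^sub>F h in at (0::real). p * \<bar>h\<bar> powr (p - 2) = (g i (0 + h) - g i 0) / h" for i
        by (auto simp: eventually_at_filter g_def x)
      then have "(g i has_real_derivative 0) (at 0)" for i
        unfolding DERIV_def by (rule Lim_transform_eventually[OF *])
      then show ?thesis using False
        by (intro exI[of _ "\<lambda>i. 0"]) (auto simp: x radial_power_def)
    qed
  next
    case x: False
    define n where "n = norm x"
    have n: "n > 0" using x by (simp add: n_def)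
    define D where "D = (\<lambda>i. p * ((p - 2) * n powr (p - 4) * (x $ i)\<^sup>2 + n powr (p - 2)))"
    have "(g i has_real_derivative D i) (at 0)" for i
    proof -
      have "((\<lambda>s. norm (x + s *\<^sub>R axis i 1) powr (p - 2)) has_real_derivative
          (p - 2) * n powr (p - 4) * (x $ i)) (at 0)"
        using norm_powr_axis_derivative[of "p - 2" x 0 i] x by (simp add: n_def)
      note this [derivative_intros]
      show ?thesis unfolding g_def
        by (auto intro!: derivative_eq_intros simp: D_def n_def power2_eq_square algebra_simps)
    qed
    moreover have "(\<Sum>i\<in>UNIV. D i) = p * (p - 2 + real CARD('n)) * radial_power (p - 2) x"
    proof -
      have "(\<Sum>i\<in>UNIV. (x $ i)\<^sup>2) = n\<^sup>2"
        unfolding n_def power2_norm_eq_inner by (simp add: inner_vec_def power2_eq_square)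
      then have "(\<Sum>i\<in>UNIV. D i) = p * ((p - 2) * n powr (p - 4) * n\<^sup>2 + real CARD('n) * n powr (p - 2))"
        unfolding D_def by (simp add: sum.distrib flip: sum_distrib_left)
      also have "n powr (p - 4) * n\<^sup>2 = n powr (p - 2)"
        using n by (simp flip: powr_numeral powr_add)
      then have "p * ((p - 2) * n powr (p - 4) * n\<^sup>2 + real CARD('n) * n powr (p - 2)) =
          p * (p - 2 + real CARD('n)) * n powr (p - 2)"
        by (simp add: algebra_simps)
      also have "n powr (p - 2) = radial_power (p - 2) x"
        using x by (simp add: radial_power_def n_def)
      finally show ?thesis .
    qed
    ultimately show ?thesis by blast
  qed
  then obtain D where D: "\<And>i. (g i has_real_derivative D i) (at 0)"
    "(\<Sum>i\<in>UNIV. D i) = p * (p - 2 + real CARD('n)) * radial_power (p - 2) x" by blast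
  then have "has_second_deriv0 (\<lambda>t. norm (x + t *\<^sub>R axis i 1) powr p) (D i)" for i
    unfolding has_second_deriv0_def using g by (intro exI[of _ "g i"]) auto
  then show ?thesis unfolding has_laplacian_def using D(2) by blast
qed

lemma scaled_norm_powr_derivative:
  fixes x :: "'a::real_normed_vector"
  assumes "s > 0"
  shows "((\<lambda>s. norm (s *\<^sub>R x) powr p) has_real_derivative p * s powr (p - 1) * norm x powr p) (at s)"
proof (rule has_field_derivative_transform_within_open[of "\<lambda>s. s powr p * norm x powr p" _ _ "{0<..}"])
  show "((\<lambda>s. s powr p * norm x powr p) has_real_derivative p * s powr (p - 1) * norm x powr p) (at s)"
    using assms by (auto intro!: derivative_eq_intros)
qed (use assms in \<open>auto simp: powr_mult\<close>)

section \<open>Partial derivatives and derivatives along lines\<close>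

lemma has_derivative_partial_deriv:
  assumes "f differentiable (at x)"
  shows "(f has_derivative (\<lambda>h. \<Sum>i\<in>UNIV. h $ i * partial_deriv i f x)) (at x)"
proof -
  from assms obtain f' where f': "(f has_derivative f') (at x)"
    unfolding differentiable_def by blast
  have pd: "partial_deriv i f x = f' (axis i 1)" for i
  proof -
    have "((\<lambda>t. x + t *\<^sub>R axis i 1) has_derivative (\<lambda>t. t *\<^sub>R axis i 1)) (at 0)"
      by (auto intro!: derivative_eq_intros)
    moreover have "(f has_derivative f') (at (x + 0 *\<^sub>R axis i 1))" using f' by simp
    ultimately have "((\<lambda>t. f (x + t *\<^sub>R axis i 1)) has_derivative (\<lambda>t. f' (t *\<^sub>R axis i 1))) (at 0)"
      by (rule has_derivative_compose)
    moreover have "(\<lambda>t. f' (t *\<^sub>R axis i 1)) = (\<lambda>t. t * f' (axis i 1))"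
      using linear_scale[OF has_derivative_linear[OF f']] by auto
    ultimately have "((\<lambda>t. f (x + t *\<^sub>R axis i 1)) has_real_derivative f' (axis i 1)) (at 0)"
      by (simp add: has_field_derivative_def mult_commute_abs)
    then show ?thesis unfolding partial_deriv_def by (rule DERIV_imp_deriv)
  qed
  have "f' h = (\<Sum>i\<in>UNIV. h $ i * f' (axis i 1))" for h
  proof -
    have "f' h = f' (\<Sum>i\<in>UNIV. h $ i *\<^sub>R axis i 1)"
      using basis_expansion[of h] by (simp add: scalar_mult_eq_scaleR)
    then show ?thesis
      by (simp add: linear_sum[OF has_derivative_linear[OF f']]
          linear_scale[OF has_derivative_linear[OF f']])
  qed
  then have "f' = (\<lambda>h. \<Sum>i\<in>UNIV. h $ i * partial_deriv i f x)" unfolding pd by (rule ext)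
  with f' show ?thesis by metis
qed

lemma line_derivative:
  assumes "f differentiable (at (a + t *\<^sub>R h))"
  shows "((\<lambda>s. f (a + s *\<^sub>R h)) has_real_derivative
     (\<Sum>i\<in>UNIV. h $ i * partial_deriv i f (a + t *\<^sub>R h))) (at t)"
proof -
  have "((\<lambda>s. a + s *\<^sub>R h) has_derivative (\<lambda>s. s *\<^sub>R h)) (at t)"
    by (auto intro!: derivative_eq_intros)
  from has_derivative_compose[OF this has_derivative_partial_deriv[OF assms]]
  have "((\<lambda>s. f (a + s *\<^sub>R h)) has_derivative
      (\<lambda>s. \<Sum>i\<in>UNIV. (s *\<^sub>R h) $ i * partial_deriv i f (a + t *\<^sub>R h))) (at t)" .
  moreover have "(\<lambda>s. \<Sum>i\<in>UNIV. (s *\<^sub>R h) $ i * partial_deriv i f (a + t *\<^sub>R h)) =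
      (*) (\<Sum>i\<in>UNIV. h $ i * partial_deriv i f (a + t *\<^sub>R h))"
    by (auto simp: fun_eq_iff sum_distrib_right intro!: sum.cong)
  ultimately show ?thesis by (simp add: has_field_derivative_def)
qed

lemma axis_line_derivative:
  assumes "f differentiable (at (a + t *\<^sub>R axis k 1))"
  shows "((\<lambda>s. f (a + s *\<^sub>R axis k 1)) has_real_derivative
     partial_deriv k f (a + t *\<^sub>R axis k 1)) (at t)"
proof -
  have "(\<Sum>i\<in>UNIV. axis k 1 $ i * g i) = g k" for g :: "_ \<Rightarrow> real"
    by (simp add: axis_def if_distrib[of "\<lambda>x. x * _"] cong: if_cong)
  then show ?thesis using line_derivative[OF assms] by simp
qed

text \<open>Links the \<open>deriv\<close>-based \<open>laplacian\<close> to the relation used here.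
  Openness keeps short axis lines inside \<open>S\<close>, where differentiability yields the first
  derivatives along them.\<close>

lemma C2_on_has_laplacian:
  assumes "open S" "C2_on S f" "x \<in> S"
  shows "has_laplacian f (laplacian f x) x"
proof -
  have "has_second_deriv0 (\<lambda>t. f (x + t *\<^sub>R axis i 1)) (partial_deriv i (partial_deriv i f) x)" for i
    unfolding has_second_deriv0_def
  proof (intro exI conjI)
    have "((\<lambda>t. x + t *\<^sub>R axis i 1) \<longlongrightarrow> x + 0 *\<^sub>R axis i 1) (at 0)"
      by (intro tendsto_intros)
    then have "((\<lambda>t::real. x + t *\<^sub>R axis i 1) \<longlongrightarrow> x) (nhds 0)"
      by (simp add: tendsto_nhds_iff)
    then have "\<forall>\<^sub>F t in nhds 0. x + t *\<^sub>R axis i 1 \<in> S"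
      using assms(1,3) topological_tendstoD by blast
    then show "\<forall>\<^sub>F t in nhds 0. ((\<lambda>t. f (x + t *\<^sub>R axis i 1)) has_real_derivative
        partial_deriv i f (x + t *\<^sub>R axis i 1)) (at t)"
      by eventually_elim (use assms(2) in \<open>auto simp: C2_on_def C1_on_def intro!: axis_line_derivative\<close>)
    show "((\<lambda>t. partial_deriv i f (x + t *\<^sub>R axis i 1)) has_real_derivative
        partial_deriv i (partial_deriv i f) x) (at 0)"
      using axis_line_derivative[of "partial_deriv i f" x 0 i] assms(2,3)
      by (auto simp: C2_on_def C1_on_def)
  qed
  then show ?thesis unfolding has_laplacian_def laplacian_def by (intro exI conjI allI) auto
qed

section \<open>The Euler operator and its boundary value problem\<close>

text \<open>The mean value theorem turns the quotient into a value of \<open>W\<close> at a nearby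
  time, and \<open>W\<close> is uniformly continuous on the compact product.\<close>

lemma uniform_difference_quotient:
  fixes V W :: "real \<Rightarrow> 'a::metric_space \<Rightarrow> real"
  assumes "compact K" "t0 > 0" "continuous_on ({a..a + t0} \<times> K) (\<lambda>(s, x). W s x)"
    and V: "\<And>s x. s \<in> {a..a + t0} \<Longrightarrow> x \<in> K \<Longrightarrow> ((\<lambda>s. V s x) has_real_derivative W s x) (at s)"
    and "\<eta> > 0"
  shows "\<exists>t>0. t \<le> t0 \<and> (\<forall>x\<in>K. \<bar>(V (a + t) x - V a x) / t - W a x\<bar> \<le> \<eta>)"
proof -
  have "uniformly_continuous_on ({a..a + t0} \<times> K) (\<lambda>(s, x). W s x)"
    by (intro compact_uniformly_continuous assms compact_Times compact_Icc)
  then obtain d where d: "d > 0" "\<And>z z'. z \<in> {a..a + t0} \<times> K \<Longrightarrow> z' \<in> {a..a + t0} \<times> K \<Longrightarrow>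
      dist z' z < d \<Longrightarrow> dist (case z' of (s, x) \<Rightarrow> W s x) (case z of (s, x) \<Rightarrow> W s x) < \<eta>"
    unfolding uniformly_continuous_on_def using \<open>\<eta> > 0\<close> by metis
  define t where "t = min t0 (d / 2)"
  have t: "t > 0" "t \<le> t0" "t < d" using assms(2) d(1) by (auto simp: t_def)
  have "\<bar>(V (a + t) x - V a x) / t - W a x\<bar> \<le> \<eta>" if "x \<in> K" for x
  proof -
    obtain z where z: "a < z" "z < a + t" "V (a + t) x - V a x = (a + t - a) * W z x"
    proof -
      have "((\<lambda>s. V s x) has_real_derivative W s x) (at s)" if "a \<le> s" "s \<le> a + t" for s
        using that t \<open>x \<in> K\<close> by (intro V) auto
      with MVT2[of a "a + t" "\<lambda>s. V s x" "\<lambda>s. W s x"] t that show thesis by auto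
    qed
    then have "(V (a + t) x - V a x) / t = W z x" using t by simp
    moreover have "dist (W z x) (W a x) < \<eta>"
      using d(2)[of "(a, x)" "(z, x)"] that t z by (auto simp: dist_Pair_Pair dist_real_def)
    ultimately show ?thesis by (simp add: dist_real_def)
  qed
  then show ?thesis using t by blast
qed

lemma locally_approx_harmonic_uminus:
  assumes "locally_approx_harmonic f y"
  shows "locally_approx_harmonic (\<lambda>x. - f x) y"
  unfolding locally_approx_harmonic_def
proof -
  from assms obtain r where r: "r > 0" "\<And>\<eta>. \<eta> > 0 \<Longrightarrow> \<exists>G. continuous_on (cball y r) G \<and>
        (\<forall>x\<in>cball y r. \<bar>G x - f x\<bar> \<le> \<eta> \<and> has_laplacian G 0 x)"
    unfolding locally_approx_harmonic_def by blast
  have "\<exists>G. continuous_on (cball y r) G \<and>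
        (\<forall>x\<in>cball y r. \<bar>G x - (- f x)\<bar> \<le> \<eta> \<and> has_laplacian G 0 x)" if \<eta>: "\<eta> > 0" for \<eta>
  proof -
    from r(2)[OF \<eta>] obtain G where G: "continuous_on (cball y r) G"
      "\<And>x. x \<in> cball y r \<Longrightarrow> \<bar>G x - f x\<bar> \<le> \<eta>" "\<And>x. x \<in> cball y r \<Longrightarrow> has_laplacian G 0 x" by blast
    have "has_laplacian (\<lambda>x. - G x) 0 x" if "x \<in> cball y r" for x
      using has_laplacian_cmult[OF G(3)[OF that], of "-1"] by simp
    moreover have "\<bar>- G x - (- f x)\<bar> \<le> \<eta>" if "x \<in> cball y r" for x using G(2)[OF that] by linarith
    ultimately show ?thesis using G(1)
      by (intro exI[of _ "\<lambda>x. - G x"]) (auto intro: continuous_intros)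
  qed
  then show "\<exists>r>0. \<forall>\<eta>>0. \<exists>G. continuous_on (cball y r) G \<and>
        (\<forall>x\<in>cball y r. \<bar>G x - (- f x)\<bar> \<le> \<eta> \<and> has_laplacian G 0 x)" using r(1) by blast
qed

text \<open>The second derivatives of \<open>v = u - A * r powr p\<close> need not be differentiable a priori, so
  \<open>x \<bullet> \<nabla>v\<close> is treated as a uniform limit of the harmonic quotients
  \<open>(v ((1 + t) x) - v x) / t\<close>.\<close>

lemma locally_approx_harmonic_euler:
  fixes u :: "real ^ 'n \<Rightarrow> real"
  assumes "open S" "C1_on S u" "x \<in> S" "p \<ge> 2"
    and lap: "\<And>y. y \<in> S \<Longrightarrow> has_laplacian (\<lambda>y. u y - A * norm y powr p) 0 y"
  shows "locally_approx_harmonic (\<lambda>y. (\<Sum>i\<in>UNIV. y $ i * partial_deriv i u y) + \<beta> * u y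
           - (p + \<beta>) * A * norm y powr p + c) x"
proof -
  define v where "v = (\<lambda>y. u y - A * norm y powr p)"
  from assms(1,3) obtain R where R: "R > 0" "cball x R \<subseteq> S" using open_contains_cball by blast
  define r where "r = R / 2"
  have r: "r > 0" using R by (simp add: r_def)
  \<comment> \<open>Points of \<open>cball x r\<close> have norm at most \<open>norm x + r\<close>,
    so a dilation by a factor up to \<open>1 + t0\<close> moves them by at most \<open>r\<close>,
    hence not out of \<open>cball x R\<close>.\<close>
  define t0 where "t0 = r / (norm x + r)"
  have nr: "norm x + r > 0" using r by (intro add_nonneg_pos) auto
  have t0: "t0 > 0" using r nr by (simp add: t0_def)
  have inS: "s *\<^sub>R y \<in> S" if "s \<in> {1..1 + t0}" "y \<in> cball x r" for s y
  proof -
    have "norm y \<le> norm x + r"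
      using that(2) norm_triangle_sub[of y x] by (simp add: dist_norm norm_minus_commute)
    then have "(s - 1) * norm y \<le> t0 * (norm x + r)"
      using that(1) t0 by (intro mult_mono) auto
    also have "\<dots> = r" using nr by (simp add: t0_def)
    finally have "norm (s *\<^sub>R y - y) \<le> r"
      using that(1) norm_scaleR[of "s - 1" y] by (simp add: scaleR_diff_left)
    moreover have "norm (y - x) \<le> r" using that(2) by (simp add: dist_norm norm_minus_commute)
    ultimately have "norm (s *\<^sub>R y - x) \<le> R"
      using norm_triangle_ineq[of "s *\<^sub>R y - y" "y - x"] by (simp add: r_def)
    then show ?thesis using R(2) by (auto simp: dist_norm norm_minus_commute)
  qed
  have sub: "cball x r \<subseteq> S" using inS[of 1] t0 by auto
  have contu: "continuous_on S u"
    using assms(2) unfolding C1_on_def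
    by (intro continuous_at_imp_continuous_on) (auto intro: differentiable_imp_continuous_within)
  have contv: "continuous_on S v"
    unfolding v_def using assms(4) by (intro continuous_intros contu continuous_on_powr') auto
  define W where "W = (\<lambda>s y. (\<Sum>i\<in>UNIV. y $ i * partial_deriv i u (s *\<^sub>R y))
      - A * (p * s powr (p - 1) * norm y powr p))"
  have "((\<lambda>s. v (s *\<^sub>R y)) has_real_derivative W s y) (at s)" if "s \<in> {1..1 + t0}" "y \<in> cball x r" for s y
  proof -
    have s: "s > 0" using that by auto
    have "((\<lambda>s. u (s *\<^sub>R y)) has_real_derivative (\<Sum>i\<in>UNIV. y $ i * partial_deriv i u (s *\<^sub>R y))) (at s)"
      using line_derivative[of u 0 s y] inS[OF that] assms(2) by (simp add: C1_on_def)
    moreover have "((\<lambda>s. norm (s *\<^sub>R y) powr p) has_real_derivative p * s powr (p - 1) * norm y powr p) (at s)"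
      using s by (rule scaled_norm_powr_derivative)
    ultimately show ?thesis unfolding v_def W_def by (intro DERIV_diff DERIV_cmult)
  qed
  moreover have "continuous_on ({1..1 + t0} \<times> cball x r) (\<lambda>(s, y). W s y)"
  proof -
    have "continuous_on ({1..1 + t0} \<times> cball x r) (\<lambda>z. partial_deriv i u (fst z *\<^sub>R snd z))" for i
      by (rule continuous_on_compose2[of S]) (use assms(2) inS in \<open>auto simp: C1_on_def intro!: continuous_intros\<close>)
    then show ?thesis unfolding W_def case_prod_beta
      using assms(4) by (intro continuous_intros continuous_on_powr') auto
  qed
  ultimately have quot: "\<exists>t>0. t \<le> t0 \<and> (\<forall>y\<in>cball x r. \<bar>(v ((1 + t) *\<^sub>R y) - v (1 *\<^sub>R y)) / t - W 1 y\<bar> \<le> \<eta>)"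
    if "\<eta> > 0" for \<eta>
    using uniform_difference_quotient[OF compact_cball t0, where V = "\<lambda>s y. v (s *\<^sub>R y)" and a = 1] that by blast
  show ?thesis unfolding locally_approx_harmonic_def
  proof (intro exI[of _ r] conjI allI impI r)
    fix \<eta> :: real assume "\<eta> > 0"
    from quot[OF this] obtain t where t: "t > 0" "t \<le> t0"
      "\<And>y. y \<in> cball x r \<Longrightarrow> \<bar>(v ((1 + t) *\<^sub>R y) - v y) / t - W 1 y\<bar> \<le> \<eta>" by auto
    have ts: "1 + t \<in> {1..1 + t0}" using t by auto
    define G where "G = (\<lambda>y. 1 / t * (v ((1 + t) *\<^sub>R y) - v y) + \<beta> * v y + c)"
    have "continuous_on (cball x r) G" unfolding G_def
      by (intro continuous_intros continuous_on_compose2[OF contv] continuous_on_subset[OF contv] sub)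
        (use inS[OF ts] in auto)
    moreover have "has_laplacian G 0 y" if y: "y \<in> cball x r" for y
    proof -
      have "has_laplacian G (1 / t * ((1 + t)\<^sup>2 * 0 - 0) + \<beta> * 0 + 0) y"
        unfolding G_def
        by (intro has_laplacian_add has_laplacian_diff has_laplacian_cmult has_laplacian_const
            has_laplacian_scale lap[folded v_def] inS[OF ts y]) (use y sub in auto)
      then show ?thesis by simp
    qed
    moreover have "\<bar>G y - ((\<Sum>i\<in>UNIV. y $ i * partial_deriv i u y) + \<beta> * u y
           - (p + \<beta>) * A * norm y powr p + c)\<bar> \<le> \<eta>" if y: "y \<in> cball x r" for y
    proof -
      \<comment> \<open>The terms with \<beta> and \<open>c\<close> match exactly, so only the error
        of the difference quotient remains.\<close>
      have "G y - ((\<Sum>i\<in>UNIV. y $ i * partial_deriv i u y) + \<beta> * u y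
           - (p + \<beta>) * A * norm y powr p + c) = (v ((1 + t) *\<^sub>R y) - v y) / t - W 1 y"
      proof -
        have "\<beta> * v y = \<beta> * u y - \<beta> * A * norm y powr p" by (simp add: v_def algebra_simps)
        then show ?thesis unfolding G_def W_def by (simp add: algebra_simps diff_divide_distrib)
      qed
      then show ?thesis using t(3)[OF y] by simp
    qed
    ultimately show "\<exists>G. continuous_on (cball x r) G \<and> (\<forall>y\<in>cball x r.
        \<bar>G y - ((\<Sum>i\<in>UNIV. y $ i * partial_deriv i u y) + \<beta> * u y
           - (p + \<beta>) * A * norm y powr p + c)\<bar> \<le> \<eta> \<and> has_laplacian G 0 y)" by blast
  qed
qed

text \<open>The left side, with the partial derivatives replaced by their continuous extensions, is
  a local uniform limit of harmonic functions in \<open>S\<close> and vanishes on the frontier. The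
  maximum principle applies to it and to its negative.\<close>

lemma euler_equation:
  fixes u :: "real ^ 'n \<Rightarrow> real"
  assumes "open S" "bounded S" "C2_closure S u" "p \<ge> 2"
    and lap: "\<And>y. y \<in> S \<Longrightarrow> has_laplacian (\<lambda>y. u y - A * norm y powr p) 0 y"
    and bd: "\<And>x. x \<in> frontier S \<Longrightarrow> (\<Sum>i\<in>UNIV. x $ i * Lim (at x within S) (partial_deriv i u))
       + \<beta> * u x - (p + \<beta>) * A * norm x powr p + c = 0"
    and "x \<in> S"
  shows "(\<Sum>i\<in>UNIV. x $ i * partial_deriv i u x) + \<beta> * u x - (p + \<beta>) * A * norm x powr p + c = 0"
proof -
  have "\<forall>i. \<exists>g. continuous_on (closure S) g \<and> (\<forall>x\<in>S. g x = partial_deriv i u x)"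
    using assms(3) unfolding C2_closure_def extends_to_closure_def by blast
  then obtain g where g: "\<And>i. continuous_on (closure S) (g i)"
    "\<And>i x. x \<in> S \<Longrightarrow> g i x = partial_deriv i u x" by metis
  have C1: "C1_on S u" and contu: "continuous_on (closure S) u"
    using assms(3) by (auto simp: C2_closure_def C2_on_def)
  define H where "H = (\<lambda>x. (\<Sum>i\<in>UNIV. x $ i * g i x) + \<beta> * u x - (p + \<beta>) * A * norm x powr p + c)"
  have contH: "continuous_on (closure S) H"
    unfolding H_def using assms(4) by (intro continuous_intros contu g continuous_on_powr') auto
  have HS: "H y = (\<Sum>i\<in>UNIV. y $ i * partial_deriv i u y) + \<beta> * u y - (p + \<beta>) * A * norm y powr p + c"
    if "y \<in> S" for y using that by (simp add: H_def g)
  have Hbd: "H y = 0" if y: "y \<in> frontier S" for y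
  proof -
    \<comment> \<open>A frontier point of the open set is a limit point of it, so \<open>Lim\<close>
      denotes an actual limit and equals the value of the extension.\<close>
    have "y \<in> closure S" "y \<notin> S" using y assms(1) by (auto simp: frontier_def interior_open)
    then have nb: "at y within S \<noteq> bot" by (simp add: trivial_limit_within closure_def)
    have "Lim (at y within S) (partial_deriv i u) = g i y" for i
    proof (rule tendsto_Lim[OF nb])
      have "(g i \<longlongrightarrow> g i y) (at y within S)"
        using g(1)[of i] \<open>y \<in> closure S\<close> closure_subset unfolding continuous_on_def
        by (meson tendsto_within_subset)
      moreover have "\<forall>\<^sub>F z in at y within S. g i z = partial_deriv i u z"
        using g(2) by (auto simp: eventually_at_filter)
      ultimately show "(partial_deriv i u \<longlongrightarrow> g i y) (at y within S)"
        using tendsto_cong by force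
    qed
    then show ?thesis using bd[OF y] by (simp add: H_def)
  qed
  have approx: "locally_approx_harmonic H y" if y: "y \<in> S" for y
  proof -
    obtain r where r: "r > 0" "cball y r \<subseteq> S" using assms(1) y open_contains_cball by blast
    from locally_approx_harmonic_euler[OF assms(1) C1 y assms(4) lap, of \<beta> c] obtain r' where
      r': "r' > 0" "\<And>\<eta>. \<eta> > 0 \<Longrightarrow> \<exists>G. continuous_on (cball y r') G \<and> (\<forall>x\<in>cball y r'.
        \<bar>G x - ((\<Sum>i\<in>UNIV. x $ i * partial_deriv i u x) + \<beta> * u x
           - (p + \<beta>) * A * norm x powr p + c)\<bar> \<le> \<eta> \<and> has_laplacian G 0 x)"
      unfolding locally_approx_harmonic_def by blast
    \<comment> \<open>The approximants are close to the expression in \<open>partial_deriv\<close>,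
      which is known to equal \<open>H\<close> only on \<open>S\<close>; hence the smaller
      ball.\<close>
    have "cball y (min r r') \<subseteq> S" "cball y (min r r') \<subseteq> cball y r'" using r by auto
    then show ?thesis unfolding locally_approx_harmonic_def
    proof (intro exI[of _ "min r r'"] conjI allI impI)
      fix \<eta> :: real assume "\<eta> > 0"
      from r'(2)[OF this] obtain G where "continuous_on (cball y r') G" "\<And>x. x\<in>cball y r' \<Longrightarrow>
        \<bar>G x - ((\<Sum>i\<in>UNIV. x $ i * partial_deriv i u x) + \<beta> * u x
           - (p + \<beta>) * A * norm x powr p + c)\<bar> \<le> \<eta> \<and> has_laplacian G 0 x" by blast
      moreover note \<open>cball y (min r r') \<subseteq> S\<close> \<open>cball y (min r r') \<subseteq> cball y r'\<close>
      ultimately show "\<exists>G. continuous_on (cball y (min r r')) G \<and>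
          (\<forall>x\<in>cball y (min r r'). \<bar>G x - H x\<bar> \<le> \<eta> \<and> has_laplacian G 0 x)"
        using HS by (intro exI[of _ G]) (auto intro: continuous_on_subset simp: subset_iff)
    qed (use r r' in auto)
  qed
  have int: "y \<in> S \<or> y \<in> frontier S" if "y \<in> closure S" for y
    using that by (auto simp: frontier_def interior_open assms(1))
  have SI: "S \<subseteq> interior (closure S)" using assms(1) by (simp add: interior_maximal closure_subset)
  have comp: "compact (closure S)" using assms(2) by simp
  have xc: "x \<in> closure S" using \<open>x \<in> S\<close> closure_subset by blast
  have alt: "H y = 0 \<or> y \<in> interior (closure S) \<and> locally_approx_harmonic H y" if "y \<in> closure S" for y
    using int[OF that] Hbd approx SI by blast
  have "H x \<le> 0"
    by (rule maximum_principle[OF comp contH _ xc]) (use alt in force)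
  moreover have "- H x \<le> 0"
    by (rule maximum_principle[OF comp continuous_on_minus[OF contH] _ xc])
      (use alt locally_approx_harmonic_uminus in force)
  ultimately show ?thesis using HS[OF \<open>x \<in> S\<close>] by simp
qed

section \<open>Homogeneity along rays, the shape of the domain, and the sign of the exponent\<close>

text \<open>The quotient of \<open>f\<close> by \<open>t powr s\<close> has derivative 0, hence is
  constant up to \<open>t = 1\<close>.\<close>

lemma euler_ode_homogeneous:
  fixes f :: "real \<Rightarrow> real"
  assumes "\<And>t. 0 < t \<Longrightarrow> t \<le> 1 \<Longrightarrow> (f has_real_derivative f' t) (at t)"
    and "\<And>t. 0 < t \<Longrightarrow> t \<le> 1 \<Longrightarrow> t * f' t = s * f t"
    and "0 < t" "t \<le> 1"
  shows "f t = t powr s * f 1"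
proof (cases "t = 1")
  case False
  define F where "F = (\<lambda>t. t powr (- s) * f t)"
  have d: "(F has_real_derivative 0) (at x)" if "0 < x" "x \<le> 1" for x
  proof -
    have "(F has_real_derivative (- s * x powr (- s - 1)) * f x + f' x * x powr (- s)) (at x)"
      unfolding F_def using that
      by (intro DERIV_mult assms(1) has_real_derivative_powr)
    moreover have "f' x = s * f x / x" using assms(2)[OF that] that by (simp add: field_simps)
    moreover have "x powr (- s - 1) = x powr (- s) / x" using that by (simp add: powr_diff)
    ultimately show ?thesis by simp
  qed
  have "F 1 = F t"
  proof (rule DERIV_isconst2[of t 1])
    show "continuous_on {t..1} F"
    proof (intro continuous_at_imp_continuous_on ballI)
      fix x assume "x \<in> {t..1}"
      then show "isCont F x" using DERIV_isCont[OF d[of x]] assms(3) by auto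
    qed
  qed (use False assms d in auto)
  then show ?thesis using assms(3) by (simp add: F_def powr_minus field_simps)
qed simp

text \<open>The first point outside \<open>S\<close> on a ray from the origin is a visible frontier
  point, hence at distance \<open>R\<close>. So the ball lies in \<open>S\<close>, and the sphere
  misses \<open>S\<close>. As \<open>S\<close> is connected and contains the origin, it cannot pass
  beyond the sphere.\<close>

lemma ball_if_equidistant_visible_frontier:
  fixes S :: "'a::euclidean_space set"
  assumes "open S" "connected S" "bounded S" "0 \<in> S"
    and vis: "\<And>x. x \<in> frontier S \<Longrightarrow> (\<And>t. 0 \<le> t \<Longrightarrow> t < 1 \<Longrightarrow> t *\<^sub>R x \<in> S) \<Longrightarrow> norm x = R"
  shows "R > 0 \<and> S = ball 0 R"
proof -
  have exit: "\<exists>T. 0 < T \<and> T \<le> 1 \<and> T *\<^sub>R y \<notin> S \<and> norm (T *\<^sub>R y) = R" if "y \<notin> S" for y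
  proof -
    define X where "X = {t \<in> {0..1}. t *\<^sub>R y \<in> - S}"
    have "closed ({0..1} \<inter> (\<lambda>t::real. t *\<^sub>R y) -` (- S))"
      using assms(1) by (intro continuous_closed_preimage continuous_intros) auto
    then have "closed X" by (simp add: X_def vimage_def Int_def)
    moreover have "bounded X" by (rule bounded_subset[of "{0..1}"]) (auto simp: X_def)
    moreover have "1 \<in> X" using that by (simp add: X_def)
    ultimately obtain T where T: "T \<in> X" "\<And>t. t \<in> X \<Longrightarrow> T \<le> t"
      using compact_attains_inf[of X] compact_eq_bounded_closed by blast
    have T01: "0 \<le> T" "T \<le> 1" "T *\<^sub>R y \<notin> S" using T(1) by (auto simp: X_def)
    have "T \<noteq> 0" using T01(3) assms(4) by auto
    then have "T > 0" using T01 by simp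
    have below: "t *\<^sub>R y \<in> S" if "0 \<le> t" "t < T" for t
      using T(2)[of t] that T01 by (force simp: X_def)
    have "((\<lambda>t. t *\<^sub>R y) \<longlongrightarrow> T *\<^sub>R y) (at_left T)" by (intro tendsto_intros)
    moreover have "\<forall>\<^sub>F t in at_left T. t *\<^sub>R y \<in> closure S"
      by (rule eventually_at_leftI[of 0]) (use below \<open>T > 0\<close> closure_subset in force)+
    ultimately have "T *\<^sub>R y \<in> closure S"
      by (intro Lim_in_closed_set[OF closed_closure _ trivial_limit_at_left_real])
    then have "T *\<^sub>R y \<in> frontier S" using T01 assms(1) by (simp add: frontier_def interior_open)
    moreover have "t *\<^sub>R T *\<^sub>R y \<in> S" if "0 \<le> t" "t < 1" for t
      using below[of "t * T"] that \<open>T > 0\<close> by simp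
    ultimately have "norm (T *\<^sub>R y) = R" by (rule vis)
    then show ?thesis using T01 \<open>T > 0\<close> by blast
  qed
  obtain B where B: "B > 0" "\<And>x. x \<in> S \<Longrightarrow> norm x \<le> B"
    using assms(3) bounded_pos by blast
  have sphere: "y \<notin> S" if y: "norm y = R" "y \<noteq> 0" for y
  proof -
    have R: "R > 0" using y by auto
    \<comment> \<open>The multiple \<open>m *\<^sub>R y\<close> is too long to lie in
      \<open>S\<close>. The first exit on the way to it has norm \<open>R\<close>, so it is
      \<open>y\<close> itself.\<close>
    define m where "m = (B + 1) / R"
    have m: "m > 0" using B R by (simp add: m_def)
    have "norm (m *\<^sub>R y) = B + 1" using y R B by (simp add: m_def)
    then have "m *\<^sub>R y \<notin> S" using B(2)[of "m *\<^sub>R y"] by auto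
    from exit[OF this] obtain T where T: "0 < T" "T *\<^sub>R m *\<^sub>R y \<notin> S" "norm (T *\<^sub>R m *\<^sub>R y) = R" by blast
    then have "T * m = 1" using y R m by (simp add: abs_mult)
    then show ?thesis using T(2) by simp
  qed
  obtain y0 :: 'a where "norm y0 = B + 1" using vector_choose_size[of "B + 1"] B by auto
  then have "y0 \<notin> S" using B(2)[of y0] by auto
  from exit[OF this] have R: "R > 0" using assms(4)
    by (metis norm_eq_zero norm_ge_zero order_less_le)
  have "ball 0 R \<subseteq> S"
  proof
    fix y :: 'a assume y: "y \<in> ball 0 R"
    show "y \<in> S"
    proof (rule ccontr)
      assume "y \<notin> S"
      from exit[OF this] obtain T where "0 < T" "T \<le> 1" "norm (T *\<^sub>R y) = R" by blast
      then have "R \<le> norm y" by (auto simp: mult_left_le_one_le)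
      then show False using y by simp
    qed
  qed
  moreover have "S \<subseteq> ball 0 R"
  proof
    fix y assume y: "y \<in> S"
    show "y \<in> ball 0 R"
    proof (rule ccontr)
      assume "y \<notin> ball 0 R"
      then have "R \<le> norm y" by simp
      moreover have "connected (norm ` S)"
        by (intro connected_continuous_image continuous_intros assms(2))
      moreover have "norm y \<in> norm ` S" "0 \<in> norm ` S" using y assms(4) by force+
      ultimately have "R \<in> norm ` S" using R connectedD_interval[of "norm ` S" 0 "norm y" R] by simp
      then show False using sphere R by force
    qed
  qed
  ultimately show ?thesis using R by blast
qed

text \<open>For \<alpha> < 0 the equation gives Laplacian 0 at the origin, by
  \<open>0 powr \<alpha> = 0\<close>, but at most -1 at nearby points, which contradicts its
  continuity.\<close>

lemma nonneg_exponent: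
  fixes u :: "real ^ 'n \<Rightarrow> real"
  assumes "open S" "0 \<in> S" "C2_on S u" "\<And>x. x \<in> S \<Longrightarrow> laplacian u x = - radial_power \<alpha> x"
  shows "\<alpha> \<ge> 0"
proof (rule ccontr)
  assume \<alpha>: "\<not> \<alpha> \<ge> 0"
  have "continuous_on S (laplacian u)"
    unfolding laplacian_def using assms(3) by (intro continuous_intros) (auto simp: C2_on_def C1_on_def)
  then have "isCont (laplacian u) 0" using assms(1,2) continuous_on_eq_continuous_at by blast
  then obtain d where d: "d > 0" "\<And>y. norm y < d \<Longrightarrow> \<bar>laplacian u y - laplacian u 0\<bar> < 1"
    unfolding continuous_at_eps_delta by (metis dist_0_norm dist_commute dist_real_def zero_less_one)
  obtain e where e: "e > 0" "ball 0 e \<subseteq> S" using assms(1,2) open_contains_ball by blast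
  define t where "t = min 1 (min d e) / 2"
  have t: "0 < t" "t < 1" "t < d" "t < e" using d(1) e(1) by (auto simp: t_def)
  obtain y :: "real ^ 'n" where y: "norm y = t" using vector_choose_size[of t] t by auto
  have "\<bar>t powr \<alpha>\<bar> < 1"
    using d(2)[of y] assms(4)[of y] assms(4)[OF assms(2)] y t e \<alpha> by (auto simp: radial_power_def subset_iff)
  moreover have "t powr \<alpha> \<ge> 1" using t \<alpha> powr_mono2'[of \<alpha> t 1] by auto
  ultimately show False by simp
qed

section \<open>Rigidity of the overdetermined problem\<close>

theorem proposition2:
  fixes \<Omega> :: "(real ^ 'n) set"
    and u :: "real ^ 'n \<Rightarrow> real"
    and \<alpha> \<beta> c0 c1 :: real
  assumes "open \<Omega>" and "connected \<Omega>" and "bounded \<Omega>" and "C2_boundary \<Omega>"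
    and "0 \<in> \<Omega>"
    and "C2_closure \<Omega> u"
    and "\<forall>x\<in>\<Omega>. laplacian u x = - radial_power \<alpha> x"
    and "\<forall>x\<in>frontier \<Omega>. u x = 0"
    and "\<forall>x\<in>frontier \<Omega>.
           (\<Sum>i\<in>UNIV. x $ i * Lim (at x within \<Omega>) (partial_deriv i u))
             + c0 * radial_power (2 + \<alpha>) x + c1 = 0"
    and "\<beta> = (\<alpha> + 2) * (c0 * (\<alpha> + real CARD('n)) - 1)"
    and "\<not> (\<beta> \<in> \<int> \<and> \<beta> < 0)"
  shows "\<exists>c R. R > 0 \<and> \<Omega> = ball c R"
proof -
  have C2: "C2_on \<Omega> u" and C1: "C1_on \<Omega> u" and contu: "continuous_on (closure \<Omega>) u"
    using assms(6) by (auto simp: C2_closure_def C2_on_def)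
  have \<alpha>: "\<alpha> \<ge> 0" using nonneg_exponent[OF assms(1,5) C2] assms(7) by blast
  define p where "p = 2 + \<alpha>"
  \<comment> \<open>The Laplacian of \<open>norm x powr p\<close> is
    \<open>q * radial_power \<alpha> x\<close>, so adding \<open>1 / q\<close> times that power to
    \<open>u\<close> cancels the right side of the equation.\<close>
  define q where "q = p * (\<alpha> + real CARD('n))"
  define A where "A = - 1 / q"
  have p: "p \<ge> 2" using \<alpha> by (simp add: p_def)
  have "\<alpha> + real CARD('n) > 0" using \<alpha> by (intro add_nonneg_pos) auto
  then have q: "q > 0" using p by (simp add: q_def)
  then have A: "A \<noteq> 0" "A * q = - 1" by (auto simp: A_def)
  \<comment> \<open>This is where the definition of \<beta> enters: the coefficient
    \<open>c0\<close> of the boundary condition becomes the one in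
    \<open>euler_equation\<close>.\<close>
  have "\<beta> = c0 * q - p" using assms(10) by (simp add: q_def p_def algebra_simps)
  then have c0: "c0 = - ((p + \<beta>) * A)" using q by (simp add: A_def)
  define v where "v = (\<lambda>x. u x - A * norm x powr p)"
  have lap: "has_laplacian (\<lambda>y. u y - A * norm y powr p) 0 y" if y: "y \<in> \<Omega>" for y
  proof -
    have "has_laplacian (\<lambda>y. u y - A * norm y powr p)
        (laplacian u y - A * (p * (p - 2 + real CARD('n)) * radial_power (p - 2) y)) y"
      by (intro has_laplacian_diff has_laplacian_cmult has_laplacian_norm_powr p
          C2_on_has_laplacian[OF assms(1) C2 y])
    moreover have "p * (p - 2 + real CARD('n)) = q" "p - 2 = \<alpha>" by (simp_all add: q_def p_def)
    moreover have "laplacian u y - A * (q * radial_power \<alpha> y) = 0"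
      using A(2) assms(7) y by (simp flip: mult.assoc)
    ultimately show ?thesis by metis
  qed
  have boundary: "(\<Sum>i\<in>UNIV. x $ i * Lim (at x within \<Omega>) (partial_deriv i u))
       + \<beta> * u x - (p + \<beta>) * A * norm x powr p + c1 = 0" if x: "x \<in> frontier \<Omega>" for x
  proof -
    have "radial_power (2 + \<alpha>) x = norm x powr p" using \<alpha> by (simp add: radial_power_def p_def)
    moreover have "u x = 0" using assms(8) x by blast
    ultimately show ?thesis using bspec[OF assms(9) x] by (simp add: c0)
  qed
  have euler: "(\<Sum>i\<in>UNIV. x $ i * partial_deriv i u x) + \<beta> * u x - (p + \<beta>) * A * norm x powr p + c1 = 0"
    if "x \<in> \<Omega>" for x
    by (rule euler_equation[OF assms(1,3,6) p lap boundary that])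
  \<comment> \<open>The constant that turns the Euler equation for \<open>v\<close> into a
    homogeneous one for \<open>z\<close>. If \<beta> = 0, the equation at the origin forces
    \<open>c1 = 0\<close>, so any constant would do, and \<open>v 0\<close> makes \<open>z\<close>
    vanish at the origin.\<close>
  define \<kappa> where "\<kappa> = (if \<beta> = 0 then v 0 else - c1 / \<beta>)"
  have \<kappa>: "\<beta> * \<kappa> = - c1"
    using euler[OF assms(5)] p by (auto simp: \<kappa>_def)
  define z where "z = (\<lambda>x. v x - \<kappa>)"
  have hom: "z (t *\<^sub>R x) = t powr (- \<beta>) * z x"
    if x: "\<And>t. 0 < t \<Longrightarrow> t \<le> 1 \<Longrightarrow> t *\<^sub>R x \<in> \<Omega>" and t: "0 < t" "t \<le> 1" for x t
  proof -
    define f' where "f' = (\<lambda>t. (\<Sum>i\<in>UNIV. x $ i * partial_deriv i u (t *\<^sub>R x)) - A * (p * t powr (p - 1) * norm x powr p))"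
    have "z (t *\<^sub>R x) = t powr (- \<beta>) * z (1 *\<^sub>R x)"
    proof (rule euler_ode_homogeneous[of "\<lambda>t. z (t *\<^sub>R x)" f', OF _ _ t])
      fix s :: real assume s: "0 < s" "s \<le> 1"
      have "((\<lambda>s. u (s *\<^sub>R x)) has_real_derivative (\<Sum>i\<in>UNIV. x $ i * partial_deriv i u (s *\<^sub>R x))) (at s)"
        using line_derivative[of u 0 s x] x[OF s] C1 by (simp add: C1_on_def)
      moreover have "((\<lambda>s. norm (s *\<^sub>R x) powr p) has_real_derivative p * s powr (p - 1) * norm x powr p) (at s)"
        using s(1) by (rule scaled_norm_powr_derivative)
      ultimately have "((\<lambda>s. u (s *\<^sub>R x) - A * norm (s *\<^sub>R x) powr p - \<kappa>) has_real_derivative f' s - 0) (at s)"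
        unfolding f'_def by (intro DERIV_diff DERIV_cmult DERIV_const)
      then show "((\<lambda>s. z (s *\<^sub>R x)) has_real_derivative f' s) (at s)"
        by (simp add: z_def v_def)
      have "s * s powr (p - 1) = s powr p" using s by (simp add: powr_diff)
      then have "s * f' s = (\<Sum>i\<in>UNIV. (s *\<^sub>R x) $ i * partial_deriv i u (s *\<^sub>R x)) - A * p * norm (s *\<^sub>R x) powr p"
        using s by (simp add: f'_def right_diff_distrib sum_distrib_left powr_mult mult_ac)
      then show "s * f' s = - \<beta> * z (s *\<^sub>R x)"
        using euler[OF x[OF s]] \<kappa> by (simp add: z_def v_def algebra_simps)
    qed
    then show ?thesis by simp
  qed
  have contv: "continuous_on \<Omega> v" unfolding v_def
    using p closure_subset by (intro continuous_intros continuous_on_subset[OF contu] continuous_on_powr') auto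
  have contz: "continuous_on \<Omega> z" unfolding z_def by (intro continuous_intros contv)
  obtain R where R: "R > 0" "cball 0 R \<subseteq> \<Omega>" using assms(1,5) open_contains_cball by blast
  have homR: "z (t *\<^sub>R x) = t powr (- \<beta>) * z x" if "x \<in> ball 0 R" "0 < t" "t \<le> 1" for x t
  proof (rule hom[OF _ that(2,3)])
    fix s :: real assume "0 < s" "s \<le> 1"
    then have "norm (s *\<^sub>R x) \<le> norm x" by (simp add: mult_left_le_one_le)
    then show "s *\<^sub>R x \<in> \<Omega>" using that(1) R by (auto simp: subset_iff)
  qed
  have "\<exists>r>0. \<forall>x\<in>ball 0 r. z x = 0"
  proof (cases "\<beta> = 0")
    case True
    have "z x = 0" if x: "x \<in> ball 0 R" for x
    proof -
      have "isCont z 0" using contz assms(1,5) continuous_on_eq_continuous_at by blast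
      moreover have "((\<lambda>t. t *\<^sub>R x) \<longlongrightarrow> 0 *\<^sub>R x) (at_right 0)" by (intro tendsto_intros)
      ultimately have "((\<lambda>t. z (t *\<^sub>R x)) \<longlongrightarrow> z 0) (at_right 0)"
        by (intro isCont_tendsto_compose[of _ z]) auto
      moreover have "\<forall>\<^sub>F t in at_right (0::real). z (t *\<^sub>R x) = z x"
        by (rule eventually_at_rightI[of 0 1]) (use homR[OF x] True in auto)
      ultimately have "((\<lambda>t::real. z x) \<longlongrightarrow> z 0) (at_right 0)"
        using tendsto_cong by force
      then have "z x = z 0" by (simp add: tendsto_const_iff)
      then show ?thesis using True by (simp add: z_def \<kappa>_def)
    qed
    then show ?thesis using R(1) by blast
  next
    case False
    have "compact (z ` cball 0 R)"
      by (intro compact_continuous_image continuous_on_subset[OF contz] R compact_cball)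
    from compact_imp_bounded[OF this] obtain M where "\<forall>w\<in>z ` cball 0 R. norm w \<le> M"
      unfolding bounded_iff by blast
    then have M: "\<bar>z y\<bar> \<le> M" if "y \<in> cball 0 R" for y using that by auto
    have sub: "ball 0 R \<subseteq> \<Omega>" using R(2) ball_subset_cball by blast
    have "has_laplacian z (0 - 0) x" if "x \<in> \<Omega>" for x
      unfolding z_def v_def by (intro has_laplacian_diff[OF lap has_laplacian_const] that)
    then have harm: "harmonic_on (ball 0 R) z"
      using sub contz unfolding harmonic_on_def by (auto intro: continuous_on_subset)
    have "- \<beta> \<notin> \<nat>"
    proof
      assume "- \<beta> \<in> \<nat>"
      then have "- \<beta> \<in> \<int>" "- \<beta> \<ge> 0" by (auto simp: Nats_altdef2)
      then show False using assms(11) False by auto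
    qed
    then show ?thesis using homogeneous_harmonic_zero[OF harm M homR] R(1) by auto
  qed
  then obtain r where r: "r > 0" "\<And>x. x \<in> ball 0 r \<Longrightarrow> z x = 0" by blast
  have zvis: "z x = 0" if x: "\<And>t. 0 < t \<Longrightarrow> t \<le> 1 \<Longrightarrow> t *\<^sub>R x \<in> \<Omega>" for x
  proof -
    \<comment> \<open>This factor brings \<open>x\<close> into the ball where \<open>z\<close> is
      known to vanish. Homogeneity carries the zero back, as \<open>t powr (- \<beta>)\<close> is
      positive.\<close>
    define t where "t = r / (r + norm x)"
    have rn: "r + norm x > 0" using r(1) by (intro add_pos_nonneg) auto
    have t: "0 < t" "t \<le> 1" using r(1) rn by (auto simp: t_def)
    have "norm (t *\<^sub>R x) < r" using r(1) rn by (simp add: t_def field_simps)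
    then have "z (t *\<^sub>R x) = 0" by (intro r) simp
    then show ?thesis using hom[OF x t] t by simp
  qed
  have "norm x = (- \<kappa> / A) powr (1 / p)"
    if x: "x \<in> frontier \<Omega>" and vis: "\<And>t. 0 \<le> t \<Longrightarrow> t < 1 \<Longrightarrow> t *\<^sub>R x \<in> \<Omega>" for x
  proof -
    have zt: "u (t *\<^sub>R x) - A * norm (t *\<^sub>R x) powr p - \<kappa> = 0" if t: "0 < t" "t < 1" for t
    proof -
      have "z (t *\<^sub>R x) = 0"
      proof (rule zvis)
        fix s :: real assume "0 < s" "s \<le> 1"
        then show "s *\<^sub>R t *\<^sub>R x \<in> \<Omega>" using vis[of "s * t"] t
          by (simp add: mult_le_one mult_le_cancel_right1 le_less_trans[of "s * t" t 1])
      qed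
      then show ?thesis by (simp add: z_def v_def)
    qed
    \<comment> \<open>\<open>w\<close> vanishes for parameters strictly between 0 and 1, hence by
      continuity also at 1. There \<open>u = 0\<close>, which leaves an equation for
      \<open>norm x\<close>.\<close>
    define w where "w = (\<lambda>t. u (t *\<^sub>R x) - A * norm (t *\<^sub>R x) powr p - \<kappa>)"
    have "t *\<^sub>R x \<in> closure \<Omega>" if "t \<in> {0..1}" for t
    proof (cases "t = 1")
      case True
      then show ?thesis using x by (simp add: frontier_def)
    next
      case False
      then show ?thesis using that vis[of t] closure_subset by force
    qed
    then have "continuous_on {0..1} w" unfolding w_def
      using p by (intro continuous_intros continuous_on_compose2[OF contu] continuous_on_powr') auto
    then have "(w \<longlongrightarrow> w 1) (at 1 within {0..1})" unfolding continuous_on_def by auto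
    then have "(w \<longlongrightarrow> w 1) (at_left 1)" by (simp add: at_within_Icc_at_left)
    moreover have "\<forall>\<^sub>F t in at_left 1. w t = 0"
      by (rule eventually_at_leftI[of 0]) (use zt in \<open>auto simp: w_def\<close>)
    ultimately have "((\<lambda>t::real. 0::real) \<longlongrightarrow> w 1) (at_left 1)" using tendsto_cong by force
    then have "w 1 = 0" by (simp add: tendsto_const_iff)
    then have "A * norm x powr p = - \<kappa>" using assms(8) x by (simp add: w_def)
    then have "norm x powr p = - \<kappa> / A" using A(1) by (simp add: field_simps)
    moreover have "(norm x powr p) powr (1 / p) = norm x" using p by (simp add: powr_powr)
    ultimately show ?thesis by simp
  qed
  from ball_if_equidistant_visible_frontier[OF assms(1,2,3,5) this] show ?thesis by blast
qed

end
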